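(* For all $m,k\in\mathbb N$ with $1\le k\le m$, \[\mathrm{BH}^{\mathrm{mult}}_{\ell_{\frac{2m}{m+1},\frac{2k}{k+1}}}(m)\le 2\binom{m}{k}^{3/2}A_{\frac{2k}{k+1}}^{\,m-k}\,\mathrm{BH}^{\mathrm{mult}}_{\ell_{\frac{2k}{k+1}}}(k).\] In particular, for each $k\in\mathbb N$ there is $\delta(k)>0$ such that for every $m>k$, \[\mathrm{BH}^{\mathrm{mult}}_{\ell_{\frac{2m}{m+1},\frac{2(m-k)}{m-k+1}}}(m)\le m^{\delta(k)}.\]
   Context: For a finite index set $I$, $1\le p<\infty$, $1\le q<\infty$, $\|x\|_{\ell_{p,q}(I)}=\big(\sum_k(x_k^* )^q(k^{q/p}-(k-1)^{q/p})\big)^{1/q}$ with $x^*$ the non-increasing rearrangement of $(|x_i|)$; $\ell_{p,p}=\ell_p$. Let $\mathcal M(m,n)=\{(i_1,\dots,i_m):1\le i_k\le n\}$; for a complex matrix $a$ on $\mathcal M(m,n)$, $\|a\|_\infty=\sup\big|\sum_{\mathbf i}a_{\mathbf i}x^1_{i_1}\cdots x^m_{i_m}\big|$ over $x^k\in\mathbb C^n$, $\|x^k\|_\infty\le1$. $\mathrm{BH}^{\mathrm{mult}}_X(m)$ is the best constant $C\ge1$ with $\|(a_{\mathbf i})_{\mathbf i\in\mathcal M(m,n)}\|_X\le C\|a\|_\infty$ for all $n$ and all $a$. For $1\le p\le2$, $A_p\ge1$ is the best constant in the Khinchine–Steinhaus inequality: $\|(\alpha_k)_{k=1}^N\|_{\ell_2}\le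 A_p\big(\int_{\mathbb T^N}|\sum_{k=1}^N\alpha_kz_k|^p\,dz\big)^{1/p}$ for all $N$ and $\alpha_k\in\mathbb C$, $dz$ the normalized Haar measure on $\mathbb T^N$. *)

theory Defs
  imports "HOL-Analysis.Analysis" "HOL-Probability.Probability" "HOL-Library.Multiset"
begin

text \<open>Non-increasing rearrangement of (|x_i|)_{i in I}, as a list (index k-1 holds x*_k).\<close>
definition decr_rearr :: "'i set \<Rightarrow> ('i \<Rightarrow> complex) \<Rightarrow> real list" where
  "decr_rearr I x = rev (sorted_list_of_multiset (image_mset (\<lambda>i. cmod (x i)) (mset_set I)))"

definition lorentz_norm :: "real \<Rightarrow> real \<Rightarrow> 'i set \<Rightarrow> ('i \<Rightarrow> complex) \<Rightarrow> real" where
  "lorentz_norm p q I x =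
     (\<Sum>k=1..card I. (decr_rearr I x ! (k - 1)) powr q
        * (real k powr (q / p) - real (k - 1) powr (q / p))) powr (1 / q)"

definition multi_idx :: "nat \<Rightarrow> nat \<Rightarrow> nat list set" where
  "multi_idx m n = {is. length is = m \<and> set is \<subseteq> {1..n}}"

text \<open>||a||_infty: sup of |sum_i a_i x^1_{i_1} ... x^m_{i_m}| over x^k in the unit ball of l_infty^n (vectors x^k are x (k-1)).\<close>
definition mult_sup_norm :: "nat \<Rightarrow> nat \<Rightarrow> (nat list \<Rightarrow> complex) \<Rightarrow> real" where
  "mult_sup_norm m n a = Sup {cmod (\<Sum>is\<in>multi_idx m n. a is * (\<Prod>j<m. x j (is ! j))) | x.
      \<forall>j<m. \<forall>l\<in>{1..n}. cmod (x j l) \<le> 1}"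

text \<open>BH^mult_{l_{p,q}}(m): best constant C >= 1 (infinity if none exists).\<close>
definition BH_mult_lorentz :: "real \<Rightarrow> real \<Rightarrow> nat \<Rightarrow> ereal" where
  "BH_mult_lorentz p q m = Inf {ereal C | C. C \<ge> 1 \<and>
      (\<forall>n (a :: nat list \<Rightarrow> complex).
          lorentz_norm p q (multi_idx m n) a \<le> C * mult_sup_norm m n a)}"

definition BH_mult_lp :: "real \<Rightarrow> nat \<Rightarrow> ereal" where
  "BH_mult_lp p m = BH_mult_lorentz p p m"

text \<open>Normalized Haar measure on T^N, realised as the uniform (Lebesgue) measure on [0,1]^N,
  with z_k = exp(2 pi i t_k).\<close>
definition torus_param :: "nat \<Rightarrow> (nat \<Rightarrow> real) measure" where
  "torus_param N = PiM {..<N} (\<lambda>_. restrict_space lborel {0..1::real})"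

definition circ :: "real \<Rightarrow> complex" where
  "circ t = cis (2 * pi * t)"

text \<open>Khinchine-Steinhaus constant A_p (best constant A >= 1; infinity if none exists).\<close>
definition KS_const :: "real \<Rightarrow> ereal" where
  "KS_const p = Inf {ereal A | A. A \<ge> 1 \<and>
      (\<forall>N (\<alpha> :: nat \<Rightarrow> complex).
          sqrt (\<Sum>k<N. (cmod (\<alpha> k))\<^sup>2)
            \<le> A * (\<integral>t. cmod (\<Sum>k<N. \<alpha> k * circ (t k)) powr p \<partial>torus_param N) powr (1 / p))}"

end

theory Submission
  imports Defs
begin

text \<open>
  For a \<open>k\<close>-subset \<open>S\<close> of the coordinates let \<open>T\<^sub>S\<close> be the \<open>q\<close>-th power of the mixed \<open>\<ell>\<^sub>q(\<ell>\<^sub>2)\<close> norm of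
  \<open>a\<close>, with \<open>\<ell>\<^sub>2\<close> taken over the coordinates outside \<open>S\<close> and \<open>q = 2k / (k + 1)\<close>. Applying the
  Khinchine-Steinhaus inequality to one outer coordinate at a time, and Minkowski's inequality,
  bounds \<open>T\<^sub>S\<close> by the \<open>q\<close>-th power of \<open>A\<^sub>q ^ (m - k) * BH(k) * \<parallel>a\<parallel>\<^sub>\<infinity>\<close>.

  The Lorentz norm to the power \<open>q\<close> is at most the sum of \<open>\<bar>a\<^sub>i\<bar>\<close> to the power \<open>q\<close> against a weight \<open>y\<^sub>i\<close>
  which is a negative power of the rank of \<open>\<bar>a\<^sub>i\<bar>\<close>. Put \<open>w = y ^ (k + 1)\<close>. The \<open>w\<close>-mass of a set \<open>E\<close> of
  indices is at most \<open>m / k\<close> times \<open>card E\<close> to the power \<open>k / m\<close>, and by Shearer's inequality the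
  latter power is at most the cardinality of some projection of \<open>E\<close> to a \<open>k\<close>-subset. Hence each index
  can be assigned to some \<open>S\<close> in such a way that every cell (a fibre of a projection) receives
  \<open>w\<close>-mass at most \<open>m / k\<close>, and Hoelder's inequality in each cell bounds the weighted sum by
  \<open>(m / k) powr (1 / (k + 1))\<close> times the sum of the \<open>T\<^sub>S\<close>.

  For the polynomial bound, Littlewood's interpolation with the fourth moment gives
  \<open>A\<^sub>q \<le> 1 + 1 / k\<close>, and Blei's inequality (again Hoelder and Shearer) with \<open>k = m - 1\<close> gives
  \<open>BH(m) \<le> A\<^sub>q * BH(m - 1)\<close>, so that \<open>BH(m) \<le> m\<close>.
\<close>

section \<open>Finite inequalities\<close>

text \<open>Jensen's inequality for \<open>exp\<close> at the points \<open>ln (u f)\<close>; a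
  vanishing \<open>u f\<close> has no logarithm and is treated apart.\<close>

lemma weighted_amgm:
  fixes u \<theta> :: "'f \<Rightarrow> real"
  assumes "finite F" "\<And>f. f \<in> F \<Longrightarrow> \<theta> f \<ge> 0" "(\<Sum>f\<in>F. \<theta> f) = 1" "\<And>f. f \<in> F \<Longrightarrow> u f \<ge> 0"
  shows "(\<Prod>f\<in>F. u f powr \<theta> f) \<le> (\<Sum>f\<in>F. \<theta> f * u f)"
proof (cases "\<exists>f\<in>F. u f = 0")
  case True
  \<comment> \<open>The convention \<open>0 powr x = 0\<close> holds for every \<open>x\<close>,
    including \<open>x = 0\<close>, so a single zero factor kills the product.\<close>
  then have "(\<Prod>f\<in>F. u f powr \<theta> f) = 0"
    using assms(1) by (auto intro!: prod_zero)
  moreover have "0 \<le> (\<Sum>f\<in>F. \<theta> f * u f)"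
    using assms by (intro sum_nonneg mult_nonneg_nonneg) auto
  ultimately show ?thesis by simp
next
  case False
  then have pos: "u f > 0" if "f \<in> F" for f
    using assms(4)[OF that] that by force
  have ne: "F \<noteq> {}" using assms(3) by auto
  have "(\<Prod>f\<in>F. u f powr \<theta> f) = exp (\<Sum>f\<in>F. \<theta> f *\<^sub>R ln (u f))"
    using assms(1) pos by (simp add: exp_sum powr_def less_imp_neq[symmetric] cong: prod.cong)
  also have "\<dots> \<le> (\<Sum>f\<in>F. \<theta> f * exp (ln (u f)))"
    using convex_on_sum[OF assms(1) ne exp_convex assms(3), of "\<lambda>f. ln (u f)"] assms(2) by simp
  also have "\<dots> = (\<Sum>f\<in>F. \<theta> f * u f)"
    using pos by (intro sum.cong) auto
  finally show ?thesis .
qed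

text \<open>Hoelder's inequality for several functions: after each \<open>g f\<close> is divided by
  its sum over \<open>Y\<close>, weighted AM-GM is applied at every point \<open>y\<close>, and the
  normalised sums add up to 1.\<close>

lemma holder_prod:
  fixes g :: "'f \<Rightarrow> 'y \<Rightarrow> real" and \<theta> :: "'f \<Rightarrow> real"
  assumes "finite F" "finite Y" "\<And>f. f \<in> F \<Longrightarrow> \<theta> f \<ge> 0" "(\<Sum>f\<in>F. \<theta> f) = 1"
    and g: "\<And>f y. f \<in> F \<Longrightarrow> y \<in> Y \<Longrightarrow> g f y \<ge> 0"
  shows "(\<Sum>y\<in>Y. \<Prod>f\<in>F. g f y powr \<theta> f) \<le> (\<Prod>f\<in>F. (\<Sum>y\<in>Y. g f y) powr \<theta> f)"
proof (cases "\<exists>f\<in>F. (\<Sum>y\<in>Y. g f y) = 0")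
  case True
  then obtain f where f: "f \<in> F" "(\<Sum>y\<in>Y. g f y) = 0" by auto
  then have "g f y = 0" if "y \<in> Y" for y
    using sum_nonneg_eq_0_iff[OF assms(2), of "g f"] g that by auto
  with f assms(1) have "(\<Prod>f\<in>F. g f y powr \<theta> f) = 0" if "y \<in> Y" for y
    using that by (auto intro!: prod_zero)
  then show ?thesis by (simp add: prod_nonneg)
next
  case False
  define s where "s f = (\<Sum>y\<in>Y. g f y)" for f
  have s: "s f > 0" if "f \<in> F" for f
    using False that g sum_nonneg[of Y "g f"] unfolding s_def by force
  have "(\<Prod>f\<in>F. g f y powr \<theta> f) = (\<Prod>f\<in>F. s f powr \<theta> f) * (\<Prod>f\<in>F. (g f y / s f) powr \<theta> f)"
    if "y \<in> Y" for y
    unfolding prod.distrib[symmetric]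
  proof (intro prod.cong refl)
    fix f assume f: "f \<in> F"
    have "g f y = s f * (g f y / s f)" using s[OF f] by simp
    then show "g f y powr \<theta> f = s f powr \<theta> f * (g f y / s f) powr \<theta> f"
      using s[OF f] g[OF f that] by (metis divide_nonneg_pos less_imp_le powr_mult)
  qed
  then have "(\<Sum>y\<in>Y. \<Prod>f\<in>F. g f y powr \<theta> f)
      = (\<Prod>f\<in>F. s f powr \<theta> f) * (\<Sum>y\<in>Y. \<Prod>f\<in>F. (g f y / s f) powr \<theta> f)"
    by (simp add: sum_distrib_left)
  also have "\<dots> \<le> (\<Prod>f\<in>F. s f powr \<theta> f) * (\<Sum>y\<in>Y. \<Sum>f\<in>F. \<theta> f * (g f y / s f))"
    by (intro mult_left_mono sum_mono weighted_amgm assms prod_nonneg)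
       (use s g in \<open>auto simp: less_imp_le\<close>)
  also have "(\<Sum>y\<in>Y. \<Sum>f\<in>F. \<theta> f * (g f y / s f)) = (\<Sum>f\<in>F. \<theta> f * ((\<Sum>y\<in>Y. g f y) / s f))"
    by (subst sum.swap) (simp add: sum_distrib_left sum_divide_distrib)
  also have "\<dots> = (\<Sum>f\<in>F. \<theta> f)"
    by (intro sum.cong refl) (simp add: s_def[symmetric] less_imp_neq[OF s, symmetric])
  finally show ?thesis using assms(4) by (simp add: s_def)
qed

lemma holder_two:
  fixes g h :: "'y \<Rightarrow> real"
  assumes "finite Y" "0 \<le> \<theta>" "\<theta> \<le> 1" "\<And>y. y \<in> Y \<Longrightarrow> g y \<ge> 0" "\<And>y. y \<in> Y \<Longrightarrow> h y \<ge> 0"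
  shows "(\<Sum>y\<in>Y. g y powr \<theta> * h y powr (1 - \<theta>)) \<le> (\<Sum>y\<in>Y. g y) powr \<theta> * (\<Sum>y\<in>Y. h y) powr (1 - \<theta>)"
  using holder_prod[of "UNIV :: bool set" Y "\<lambda>b. if b then \<theta> else 1 - \<theta>" "\<lambda>b. if b then g else h"] assms
  by (simp add: UNIV_bool mult.commute split: if_splits)

section \<open>Shearer's inequality and the greedy assignment to projections\<close>

lemma sum_PiE_insert:
  fixes f :: "('a \<Rightarrow> 'b) \<Rightarrow> 'c::comm_monoid_add"
  assumes "t \<notin> M"
  shows "(\<Sum>i\<in>PiE (insert t M) X. f i) = (\<Sum>y\<in>X t. \<Sum>i\<in>PiE M X. f (i(t := y)))"
  unfolding PiE_insert_eq
  by (subst sum.reindex[OF inj_combinator[OF assms]]) (simp add: sum.cartesian_product split_beta)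

text \<open>Functional form of Shearer's inequality, by induction on the coordinates. Fix the value
  \<open>y\<close> of the new coordinate \<open>t\<close>, apply the induction hypothesis to the
  slices, then sum over \<open>y\<close>: exactly \<open>D\<close> of the sets contain
  \<open>t\<close>, so Hoelder's inequality with \<open>D\<close> exponents \<open>1 / D\<close>
  applies to them, while the factors of the other sets do not depend on \<open>y\<close>.\<close>

lemma shearer:
  fixes M :: "'a set" and S :: "'f \<Rightarrow> 'a set" and G :: "'f \<Rightarrow> ('a \<Rightarrow> 'b) \<Rightarrow> real"
  assumes "finite M" "finite F" "D \<ge> (1::nat)" "\<And>t. t \<in> M \<Longrightarrow> finite (X t)"
    and "\<And>f. f \<in> F \<Longrightarrow> S f \<subseteq> M"
    and "\<And>t. t \<in> M \<Longrightarrow> card {f\<in>F. t \<in> S f} = D"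
    and "\<And>f x. f \<in> F \<Longrightarrow> G f x \<ge> 0"
  shows "(\<Sum>i\<in>PiE M X. \<Prod>f\<in>F. G f (restrict i (S f)) powr (1 / D))
      \<le> (\<Prod>f\<in>F. (\<Sum>x\<in>PiE (S f) X. G f x) powr (1 / D))"
  using assms
proof (induction M arbitrary: S G rule: finite_induct)
  case empty
  then have "S f = {}" if "f \<in> F" for f using that by auto
  then show ?case by (simp cong: prod.cong)
next
  case (insert t M)
  define A where "A = {f\<in>F. t \<in> S f}"
  define B where "B = {f\<in>F. t \<notin> S f}"
  have F: "F = A \<union> B" "A \<inter> B = {}" "finite A" "finite B"
    using \<open>finite F\<close> by (auto simp: A_def B_def)
  have cA: "card A = D" using insert.prems(5)[of t] by (simp add: A_def)
  \<comment> \<open>\<open>G' y f\<close> is the slice of \<open>G f\<close> at the value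
    \<open>y\<close> of coordinate \<open>t\<close>, seen as a function on the remaining coordinates
    \<open>S' f\<close>.\<close>
  define S' where "S' f = S f - {t}" for f
  define G' where "G' y f x = (if t \<in> S f then G f (x(t := y)) else G f x)" for y f x
  have restr: "G f (restrict (i(t := y)) (S f)) = G' y f (restrict i (S' f))" for f i y
  proof (cases "t \<in> S f")
    case True
    then have "restrict (i(t := y)) (S f) = (restrict i (S' f))(t := y)"
      by (auto simp: S'_def restrict_def fun_eq_iff)
    with True show ?thesis by (simp add: G'_def)
  next
    case False
    then have "restrict (i(t := y)) (S f) = restrict i (S' f)"
      by (auto simp: S'_def restrict_def fun_eq_iff)
    with False show ?thesis by (simp add: G'_def)
  qed
  define g where "g f y = (\<Sum>x\<in>PiE (S' f) X. G' y f x)" for f y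
  have g0: "g f y \<ge> 0" if "f \<in> F" for f y
    using insert.prems(6)[OF that] by (auto simp: g_def G'_def intro!: sum_nonneg)
  have IH: "(\<Sum>i\<in>PiE M X. \<Prod>f\<in>F. G' y f (restrict i (S' f)) powr (1 / D))
      \<le> (\<Prod>f\<in>F. g f y powr (1 / D))" for y
    unfolding g_def
  proof (rule insert.IH)
    fix s assume s: "s \<in> M"
    have "{f\<in>F. s \<in> S' f} = {f\<in>F. s \<in> S f}" using s insert.hyps by (auto simp: S'_def)
    then show "card {f\<in>F. s \<in> S' f} = D" using insert.prems(5)[of s] s by simp
  qed (use insert.prems insert.hyps in \<open>auto simp: S'_def G'_def\<close>)
  have gB: "g f y = (\<Sum>x\<in>PiE (S f) X. G f x)" if "f \<in> B" for f y
    using that by (auto simp: g_def G'_def B_def S'_def)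
  have gA: "(\<Sum>y\<in>X t. g f y) = (\<Sum>x\<in>PiE (S f) X. G f x)" if "f \<in> A" for f
  proof -
    have "S f = insert t (S' f)" "t \<notin> S' f" using that by (auto simp: S'_def A_def)
    then show ?thesis using that sum_PiE_insert[of t "S' f" "G f" X]
      by (simp add: g_def G'_def A_def)
  qed
  have "(\<Sum>i\<in>PiE (insert t M) X. \<Prod>f\<in>F. G f (restrict i (S f)) powr (1 / D))
      = (\<Sum>y\<in>X t. \<Sum>i\<in>PiE M X. \<Prod>f\<in>F. G' y f (restrict i (S' f)) powr (1 / D))"
    by (simp add: sum_PiE_insert[OF insert.hyps(2)] restr)
  also have "\<dots> \<le> (\<Sum>y\<in>X t. \<Prod>f\<in>F. g f y powr (1 / D))"
    by (intro sum_mono IH)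
  also have "\<dots> = (\<Sum>y\<in>X t. (\<Prod>f\<in>A. g f y powr (1 / D)) * (\<Prod>f\<in>B. g f y powr (1 / D)))"
    unfolding F(1) using F by (simp add: prod.union_disjoint)
  also have "\<dots> = (\<Sum>y\<in>X t. \<Prod>f\<in>A. g f y powr (1 / D)) *
      (\<Prod>f\<in>B. (\<Sum>x\<in>PiE (S f) X. G f x) powr (1 / D))"
    by (simp add: gB sum_distrib_right)
  also have "\<dots> \<le> (\<Prod>f\<in>A. (\<Sum>y\<in>X t. g f y) powr (1 / D)) *
      (\<Prod>f\<in>B. (\<Sum>x\<in>PiE (S f) X. G f x) powr (1 / D))"
    by (intro mult_right_mono holder_prod prod_nonneg)
       (use F cA insert.prems g0 in auto)
  also have "\<dots> = (\<Prod>f\<in>F. (\<Sum>x\<in>PiE (S f) X. G f x) powr (1 / D))"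
    unfolding F(1) using F by (simp add: prod.union_disjoint gA)
  finally show ?case .
qed

text \<open>By averaging, some cell of some projection carries weight at most \<open>C\<close>; assign its elements to that
  projection, discard them, and repeat.\<close>

lemma greedy_assignment:
  fixes w :: "'i \<Rightarrow> real" and C :: real and \<pi> :: "'f \<Rightarrow> 'i \<Rightarrow> 'x"
  assumes "finite E" "\<And>i. i \<in> E \<Longrightarrow> w i \<ge> 0" "C \<ge> 0"
    and "\<And>E'. E' \<subseteq> E \<Longrightarrow> E' \<noteq> {} \<Longrightarrow> \<exists>f\<in>F. (\<Sum>i\<in>E'. w i) \<le> C * card (\<pi> f ` E')"
  shows "\<exists>\<tau>. (\<forall>i\<in>E. \<tau> i \<in> F) \<and> (\<forall>f\<in>F. \<forall>x. (\<Sum>i\<in>{i\<in>E. \<tau> i = f \<and> \<pi> f i = x}. w i) \<le> C)"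
  using assms
proof (induction E rule: finite_psubset_induct)
  case (psubset E)
  show ?case
  proof (cases "E = {}")
    case True then show ?thesis using psubset.prems(2) by auto
  next
    case False
    then obtain f where f: "f \<in> F" "(\<Sum>i\<in>E. w i) \<le> C * card (\<pi> f ` E)"
      using psubset.prems(3)[of E] by auto
    have "\<exists>x\<in>\<pi> f ` E. (\<Sum>i\<in>{i\<in>E. \<pi> f i = x}. w i) \<le> C"
    proof (rule ccontr)
      assume "\<not> ?thesis"
      then have "(\<Sum>x\<in>\<pi> f ` E. C) < (\<Sum>x\<in>\<pi> f ` E. \<Sum>i\<in>{i\<in>E. \<pi> f i = x}. w i)"
        using False psubset.hyps by (intro sum_strict_mono) (auto simp: not_le)
      also have "\<dots> = (\<Sum>i\<in>E. w i)"
        using psubset.hyps by (subst sum.group) auto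
      finally show False using f by (simp add: mult.commute)
    qed
    then obtain x where x: "x \<in> \<pi> f ` E" "(\<Sum>i\<in>{i\<in>E. \<pi> f i = x}. w i) \<le> C" by auto
    define E' where "E' = {i\<in>E. \<pi> f i \<noteq> x}"
    have "E' \<subset> E" using x by (auto simp: E'_def)
    have "\<exists>\<tau>. (\<forall>i\<in>E'. \<tau> i \<in> F) \<and> (\<forall>f\<in>F. \<forall>x. (\<Sum>i\<in>{i\<in>E'. \<tau> i = f \<and> \<pi> f i = x}. w i) \<le> C)"
    proof (rule psubset.IH[OF \<open>E' \<subset> E\<close>])
      fix E'' assume "E'' \<subseteq> E'" "E'' \<noteq> {}"
      then show "\<exists>f\<in>F. (\<Sum>i\<in>E''. w i) \<le> C * card (\<pi> f ` E'')"
        using psubset.prems(3) \<open>E' \<subset> E\<close> by blast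
    qed (use psubset.prems \<open>E' \<subset> E\<close> in auto)
    then obtain \<tau> where \<tau>: "\<forall>i\<in>E'. \<tau> i \<in> F"
        "\<And>f y. f\<in>F \<Longrightarrow> (\<Sum>i\<in>{i\<in>E'. \<tau> i = f \<and> \<pi> f i = y}. w i) \<le> C"
      by auto
    define \<tau>' where "\<tau>' i = (if i \<in> E' then \<tau> i else f)" for i
    have "(\<Sum>i\<in>{i\<in>E. \<tau>' i = f' \<and> \<pi> f' i = y}. w i) \<le> C" if "f' \<in> F" for f' y
    \<comment> \<open>No element of \<open>E'\<close> projects to \<open>x\<close> under
      \<open>f\<close>, so the cell of \<open>f\<close> and \<open>x\<close> consists of the
      discarded elements only, and every other cell is inherited from \<open>\<tau>\<close>.\<close>
    proof (cases "f' = f \<and> y = x")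
      case True
      then have "{i\<in>E. \<tau>' i = f' \<and> \<pi> f' i = y} = {i\<in>E. \<pi> f i = x}"
        by (auto simp: \<tau>'_def E'_def)
      then show ?thesis using x by simp
    next
      case False
      then have "{i\<in>E. \<tau>' i = f' \<and> \<pi> f' i = y} = {i\<in>E'. \<tau> i = f' \<and> \<pi> f' i = y}"
        by (auto simp: \<tau>'_def E'_def)
      then show ?thesis using \<tau> that by simp
    qed
    then show ?thesis using \<tau> f by (intro exI[of _ \<tau>']) (auto simp: \<tau>'_def E'_def)
  qed
qed

section \<open>Power estimates for the Lorentz weights\<close>

lemma powr_diff_le:
  assumes "0 \<le> s" "s \<le> 1" "l \<ge> (1::nat)"
  shows "real l powr s - real (l - 1) powr s \<le> real l powr (s - 1)"
\<comment> \<open>For \<open>l > 1\<close> both powers are split off as base times a power with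
  exponent \<open>s - 1\<close>, which is antitone on positive bases; \<open>l - 1 = 0\<close> has
  to be excluded for this.\<close>
proof (cases "l = 1")
  case False
  then have l: "l > 1" using assms by simp
  have "real l powr s = real l powr (s - 1) * real l" using l by (simp add: powr_diff)
  moreover have "real (l - 1) powr s = real (l - 1) powr (s - 1) * real (l - 1)" using l by (simp add: powr_diff)
  moreover have "real (l - 1) powr (s - 1) * real (l - 1) \<ge> real l powr (s - 1) * real (l - 1)"
    using l assms by (intro mult_right_mono powr_mono2') auto
  moreover have "real l powr (s - 1) * real l = real l powr (s - 1) * real (l - 1) + real l powr (s - 1)"
    using l by (simp add: of_nat_diff algebra_simps)
  ultimately show ?thesis by linarith
qed simp

text \<open>Young's inequality for \<open>r = (l - 1) / l\<close> and 1 with weights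
  \<open>s\<close> and \<open>1 - s\<close>, multiplied by \<open>real l powr s\<close>. The
  right-hand side telescopes, which yields the bound for power sums below.\<close>

lemma powr_diff_ge:
  assumes "0 < s" "s \<le> 1" "l \<ge> (1::nat)"
  shows "s * real l powr (s - 1) \<le> real l powr s - real (l - 1) powr s"
proof -
  define r where "r = real (l - 1) / real l"
  have r: "0 \<le> r" "r = 1 - 1 / real l" using assms by (auto simp: r_def field_simps of_nat_diff)
  have "r powr s * 1 powr (1 - s) \<le> s * r + (1 - s) * 1"
  proof (cases "r = 0")
    case False
    then show ?thesis using assms r(1) by (intro Youngs_inequality_0) auto
  qed (use assms in auto)
  then have "real l powr s * r powr s \<le> real l powr s * (1 - s / real l)"
    by (intro mult_left_mono) (auto simp: r(2) algebra_simps)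
  moreover have "real l powr s * r powr s = real (l - 1) powr s"
    using assms by (subst powr_mult[symmetric]) (auto simp: r_def)
  moreover have "real l powr s * (1 - s / real l) = real l powr s - s * real l powr (s - 1)"
    using assms by (simp add: powr_diff algebra_simps)
  ultimately show ?thesis by linarith
qed

lemma sum_powr_le:
  assumes "0 < s" "s \<le> 1"
  shows "(\<Sum>l=1..n. real l powr (s - 1)) \<le> real n powr s / s"
proof (induction n)
  case (Suc n)
  then show ?case
    using powr_diff_ge[OF assms, of "Suc n"] assms by (simp add: field_simps)
qed (use assms in simp)

text \<open>Remove the largest element: it is at least \<open>card E\<close> because
  \<open>E\<close> consists of positive integers, so its term is at most the last term of the
  initial segment.\<close>

lemma sum_antimono_le_initial:
  fixes g :: "nat \<Rightarrow> real"
  assumes "finite E" "E \<subseteq> {1..}" "\<And>a b. 1 \<le> a \<Longrightarrow> a \<le> b \<Longrightarrow> g b \<le> g a"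
  shows "(\<Sum>l\<in>E. g l) \<le> (\<Sum>l=1..card E. g l)"
  using assms(1,2)
proof (induction "card E" arbitrary: E)
  case (Suc c)
  then have ne: "E \<noteq> {}" by auto
  have M: "Max E \<in> E" using Suc ne by simp
  have c: "card (E - {Max E}) = c" using Suc M by simp
  have "E \<subseteq> {1..Max E}" using Suc.prems by (auto simp: subset_iff)
  then have "card E \<le> Max E" using card_mono[of "{1..Max E}" E] by simp
  then have "g (Max E) \<le> g (Suc c)" using Suc assms(3)[of "Suc c" "Max E"] by simp
  moreover have "(\<Sum>l\<in>E - {Max E}. g l) \<le> (\<Sum>l=1..c. g l)"
    using Suc(1)[of "E - {Max E}"] c Suc.prems by auto
  moreover have "(\<Sum>l\<in>E. g l) = g (Max E) + (\<Sum>l\<in>E - {Max E}. g l)"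
    using Suc.prems M by (simp add: sum.remove)
  ultimately show ?case using Suc(2)[symmetric] by simp
qed simp

section \<open>Lorentz norms\<close>

text \<open>Moves the sum from ranks back to indices. The rank \<open>\<rho>\<close> comes from
  sorting the indices by modulus, with ties broken by the sort, so it is a bijection and serves all
  \<open>p\<close> and \<open>q\<close> at once.\<close>

lemma lorentz_norm_enum:
  fixes a :: "'i \<Rightarrow> complex"
  assumes "finite I"
  shows "\<exists>\<rho>. bij_betw \<rho> I {1..card I} \<and> (\<forall>p q. lorentz_norm p q I a =
    (\<Sum>i\<in>I. cmod (a i) powr q * (real (\<rho> i) powr (q / p) - real (\<rho> i - 1) powr (q / p))) powr (1 / q))"
proof -
  obtain xs where xs: "set xs = I" "distinct xs" using finite_distinct_list[OF assms] by auto
  define c where "c i = cmod (a i)" for i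
  define ys where "ys = rev (sort_key c xs)"
  have ys: "set ys = I" "distinct ys" using xs by (auto simp: ys_def)
  have len: "length ys = card I" using ys distinct_card by fastforce
  have "image_mset c (mset_set I) = mset (map c xs)"
    using mset_set_set[OF xs(2)] xs(1) by simp
  \<comment> \<open>The rearrangement records values only; sorting the indices by the key
    \<open>c\<close> also remembers which index carries each value.\<close>
  moreover have "sort (map c xs) = map c (sort_key c xs)"
    by (rule properties_for_sort) auto
  ultimately have "sorted_list_of_multiset (image_mset c (mset_set I)) = map c (sort_key c xs)"
    by (metis sorted_list_of_multiset_mset)
  then have decr: "decr_rearr I a = map c ys"
    by (simp add: decr_rearr_def ys_def c_def[symmetric] rev_map)
  have e: "bij_betw (\<lambda>l. ys ! (l - 1)) {1..card I} I"
  proof -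
    have "bij_betw (\<lambda>l. l - 1) {1..card I} {..<card I}"
      by (rule bij_betw_byWitness[where f' = Suc]) auto
    moreover have "bij_betw (\<lambda>l. ys ! l) {..<card I} I"
      using ys len by (intro bij_betw_nth) auto
    ultimately show ?thesis using bij_betw_trans by (fastforce simp: o_def)
  qed
  define \<rho> where "\<rho> = the_inv_into {1..card I} (\<lambda>l. ys ! (l - 1))"
  have \<rho>: "bij_betw \<rho> I {1..card I}" unfolding \<rho>_def by (rule bij_betw_the_inv_into[OF e])
  have \<rho>e: "\<rho> (ys ! (l - 1)) = l" if "l \<in> {1..card I}" for l
    unfolding \<rho>_def using the_inv_into_f_f[OF bij_betw_imp_inj_on[OF e] that] by simp
  have "(\<Sum>i\<in>I. c i powr q * (real (\<rho> i) powr (q / p) - real (\<rho> i - 1) powr (q / p)))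
     = (\<Sum>l=1..card I. c (ys ! (l - 1)) powr q * (real l powr (q / p) - real (l - 1) powr (q / p)))"
    for p q
  proof -
    have "(\<Sum>i\<in>I. c i powr q * (real (\<rho> i) powr (q / p) - real (\<rho> i - 1) powr (q / p)))
      = (\<Sum>l=1..card I. c (ys ! (l - 1)) powr q *
          (real (\<rho> (ys ! (l - 1))) powr (q / p) - real (\<rho> (ys ! (l - 1)) - 1) powr (q / p)))"
      by (rule sum.reindex_bij_betw[OF e, symmetric])
    also have "\<dots> = (\<Sum>l=1..card I. c (ys ! (l - 1)) powr q * (real l powr (q / p) - real (l - 1) powr (q / p)))"
      by (intro sum.cong refl) (simp only: \<rho>e)
    finally show ?thesis .
  qed
  moreover have "decr_rearr I a ! (l - 1) = c (ys ! (l - 1))" if "l \<in> {1..card I}" for l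
    using that len by (auto simp: decr)
  ultimately show ?thesis using \<rho> unfolding lorentz_norm_def c_def[symmetric]
    by (intro exI[of _ \<rho>]) (simp cong: sum.cong_simp)
qed

text \<open>For \<open>p = q\<close> every weight is \<open>l - (l - 1) = 1\<close>, so the ranks
  disappear.\<close>

lemma lorentz_norm_diag:
  assumes "finite I" "q > 0"
  shows "lorentz_norm q q I a = (\<Sum>i\<in>I. cmod (a i) powr q) powr (1 / q)"
proof -
  obtain \<rho> where \<rho>: "bij_betw \<rho> I {1..card I}" "lorentz_norm q q I a =
    (\<Sum>i\<in>I. cmod (a i) powr q * (real (\<rho> i) powr (q / q) - real (\<rho> i - 1) powr (q / q))) powr (1 / q)"
    using lorentz_norm_enum[OF assms(1)] by blast
  have "\<rho> i \<ge> 1" if "i \<in> I" for i using bij_betwE[OF \<rho>(1)] that by auto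
  then show ?thesis using assms unfolding \<rho>(2) by (simp add: of_nat_diff cong: sum.cong)
qed

lemma lorentz_norm_reindex:
  assumes "bij_betw \<phi> J I"
  shows "lorentz_norm p q I a = lorentz_norm p q J (a \<circ> \<phi>)"
proof -
  have "mset_set I = image_mset \<phi> (mset_set J)"
    using assms by (simp add: image_mset_mset_set bij_betw_def)
  then show ?thesis using bij_betw_same_card[OF assms]
    by (simp add: lorentz_norm_def decr_rearr_def multiset.map_comp o_def)
qed

section \<open>Mixed-norm inequalities over projections\<close>

definition ksubsets :: "nat \<Rightarrow> 'a set \<Rightarrow> 'a set set" where
  "ksubsets k M = {S. S \<subseteq> M \<and> card S = k}"

lemma finite_ksubsets [simp]: "finite M \<Longrightarrow> finite (ksubsets k M)"
  by (auto simp: ksubsets_def)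

lemma card_ksubsets: "finite M \<Longrightarrow> card (ksubsets k M) = card M choose k"
  by (simp add: ksubsets_def n_subsets)

text \<open>Deleting \<open>t\<close> is a bijection onto the \<open>(k - 1)\<close>-subsets of the
  rest. This is the covering multiplicity required by \<open>shearer\<close>.\<close>

lemma card_ksubsets_containing:
  assumes "finite M" "t \<in> M" "k \<ge> 1"
  shows "card {S \<in> ksubsets k M. t \<in> S} = (card M - 1) choose (k - 1)"
proof -
  have "bij_betw (\<lambda>S. S - {t}) {S \<in> ksubsets k M. t \<in> S} (ksubsets (k - 1) (M - {t}))"
  proof (rule bij_betw_byWitness[where f' = "insert t"])
    show "(\<lambda>S. S - {t}) ` {S \<in> ksubsets k M. t \<in> S} \<subseteq> ksubsets (k - 1) (M - {t})"
      by (auto simp: ksubsets_def)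
    show "insert t ` ksubsets (k - 1) (M - {t}) \<subseteq> {S \<in> ksubsets k M. t \<in> S}"
    proof
      fix R assume "R \<in> insert t ` ksubsets (k - 1) (M - {t})"
      then obtain S where S: "S \<subseteq> M - {t}" "card S = k - 1" "R = insert t S"
        by (auto simp: ksubsets_def)
      moreover have "card R = k"
        using S assms finite_subset[of S M] by (subst S(3), subst card_insert_disjoint) auto
      ultimately show "R \<in> {S \<in> ksubsets k M. t \<in> S}" using assms by (auto simp: ksubsets_def)
    qed
  qed (auto simp: ksubsets_def)
  then show ?thesis using assms by (simp add: bij_betw_same_card card_ksubsets)
qed

definition cell_mass :: "'a set \<Rightarrow> ('a \<Rightarrow> 'b set) \<Rightarrow> (('a \<Rightarrow> 'b) \<Rightarrow> real) \<Rightarrow> 'a set \<Rightarrow> ('a \<Rightarrow> 'b) \<Rightarrow> real" where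
  "cell_mass M X f S x = (\<Sum>i\<in>{i\<in>PiE M X. restrict i S = x}. (f i)\<^sup>2)"

text \<open>This is the \<open>T\<^sub>S\<close> of the overview: the exponent \<open>q / 2\<close>
  occurs because \<open>cell_mass\<close> is the square of the \<ell>2 norm on a fibre.\<close>

definition block_sum :: "real \<Rightarrow> 'a set \<Rightarrow> ('a \<Rightarrow> 'b set) \<Rightarrow> (('a \<Rightarrow> 'b) \<Rightarrow> real) \<Rightarrow> 'a set \<Rightarrow> real" where
  "block_sum q M X f S = (\<Sum>x\<in>PiE S X. cell_mass M X f S x powr (q / 2))"

lemma cell_mass_nonneg [simp]: "cell_mass M X f S x \<ge> 0"
  by (auto simp: cell_mass_def intro!: sum_nonneg)

lemma block_sum_nonneg [simp]: "block_sum q M X f S \<ge> 0"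
  by (auto simp: block_sum_def intro!: sum_nonneg)

lemma restrict_image_PiE: "S \<subseteq> M \<Longrightarrow> (\<lambda>i. restrict i S) ` PiE M X \<subseteq> PiE S X"
  by (auto simp: PiE_def Pi_def extensional_def)

locale blei_setup =
  fixes M :: "'a set" and X :: "'a \<Rightarrow> 'b set" and k m :: nat and f :: "('a \<Rightarrow> 'b) \<Rightarrow> real"
  assumes finM: "finite M" and cardM: "card M = m" and k: "1 \<le> k" "k \<le> m"
    and finX: "\<And>t. t \<in> M \<Longrightarrow> finite (X t)" and f0: "\<And>i. f i \<ge> 0"
begin

text \<open>\<open>N\<close> is the number of projections and \<open>D\<close> the number of those
  that see a given coordinate; \<open>N / D = m / k\<close> is the exponent that Shearer's
  inequality produces.\<close>

definition "N = real (m choose k)"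
definition "D = ((m - 1) choose (k - 1))"

lemma D_pos: "D \<ge> 1"
  using k by (simp add: D_def Suc_leI zero_less_binomial)

lemma N_pos: "N > 0"
  using k by (simp add: N_def zero_less_binomial)

lemma card_N: "real (card (ksubsets k M)) = N"
  using card_ksubsets[OF finM, of k] cardM by (simp add: N_def)

lemma N_eq: "N / real D = real m / real k"
proof -
  have "k * (m choose k) = m * D"
    using times_binomial_minus1_eq[of k m] k by (simp add: D_def)
  then have "real k * N = real m * real D" unfolding N_def by (metis of_nat_mult)
  then show ?thesis using D_pos k by (simp add: field_simps)
qed

lemma fin: "finite (PiE M X)"
  using finM finX by (intro finite_PiE)

lemma subsetD': "S \<in> ksubsets k M \<Longrightarrow> S \<subseteq> M"
  by (auto simp: ksubsets_def)

lemma ksubsets_nonempty: "ksubsets k M \<noteq> {}"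
  using card_ksubsets[OF finM, of k] cardM N_pos by (auto simp: N_def)

lemma shearer_ksubsets:
  assumes "\<And>S x. S \<in> ksubsets k M \<Longrightarrow> G S x \<ge> 0"
  shows "(\<Sum>i\<in>PiE M X. \<Prod>S\<in>ksubsets k M. G S (restrict i S) powr (1 / D))
    \<le> (\<Prod>S\<in>ksubsets k M. (\<Sum>x\<in>PiE S X. G S x) powr (1 / D))"
  using shearer[of M "ksubsets k M" D X "\<lambda>S. S" G] finM D_pos finX assms
    card_ksubsets_containing[OF finM _ k(1)] cardM
  by (simp add: D_def subsetD')

lemma prod_ksubsets_le:
  assumes "\<And>S. S \<in> ksubsets k M \<Longrightarrow> 0 \<le> u S \<and> u S \<le> c" "r \<ge> 0" "c \<ge> 0"
  shows "(\<Prod>S\<in>ksubsets k M. u S powr r) \<le> c powr (r * N)"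
proof -
  have "(\<Prod>S\<in>ksubsets k M. u S powr r) \<le> (\<Prod>S\<in>ksubsets k M. c powr r)"
    using assms by (intro prod_mono) (auto intro!: powr_mono2)
  also have "\<dots> = c powr (r * N)"
    using assms(3) N_pos card_N finM ksubsets_nonempty
    by (cases "c = 0") (simp_all add: powr_realpow[symmetric] powr_powr card_gt_0_iff)
  finally show ?thesis .
qed

text \<open>Shearer's inequality for the indicators of the projections of \<open>E\<close> bounds
  \<open>card E\<close> by the product of their cardinalities to the power \<open>1 / D\<close>.
  Replacing each by the largest, \<open>c\<close>, gives \<open>c powr (m / k)\<close>.\<close>

lemma card_powr_le_projection:
  assumes "E \<subseteq> PiE M X"
  shows "\<exists>S\<in>ksubsets k M. real (card E) powr (k / m) \<le> card ((\<lambda>i. restrict i S) ` E)"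
proof -
  define P where "P S = (\<lambda>i. restrict i S) ` E" for S
  have finE: "finite E" using assms fin finite_subset by auto
  define c where "c = Max ((\<lambda>S. card (P S)) ` ksubsets k M)"
  have "c \<in> (\<lambda>S. card (P S)) ` ksubsets k M"
    unfolding c_def using ksubsets_nonempty finM by (intro Max_in) auto
  then obtain S where S: "S \<in> ksubsets k M" "card (P S) = c" by auto
  have c: "card (P S) \<le> c" if "S \<in> ksubsets k M" for S
    unfolding c_def using that finM by auto
  have PS: "P S \<subseteq> PiE S X" if "S \<in> ksubsets k M" for S
    using restrict_image_PiE[OF subsetD'[OF that], of X] assms unfolding P_def by blast
  define G where "G S x = (if x \<in> P S then 1 else 0 :: real)" for S x
  have "real (card E) = (\<Sum>i\<in>E. \<Prod>S\<in>ksubsets k M. G S (restrict i S) powr (1 / D))"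
    by (simp add: G_def P_def)
  also have "\<dots> \<le> (\<Sum>i\<in>PiE M X. \<Prod>S\<in>ksubsets k M. G S (restrict i S) powr (1 / D))"
    by (intro sum_mono2 fin assms prod_nonneg) auto
  also have "\<dots> \<le> (\<Prod>S\<in>ksubsets k M. (\<Sum>x\<in>PiE S X. G S x) powr (1 / D))"
    by (rule shearer_ksubsets) (simp add: G_def)
  also have "\<dots> = (\<Prod>S\<in>ksubsets k M. real (card (P S)) powr (1 / D))"
  proof (intro prod.cong refl arg_cong2[where f = "(powr)"])
    fix S assume S: "S \<in> ksubsets k M"
    have "finite (PiE S X)" using subsetD'[OF S] finM finX by (intro finite_PiE) (auto intro: finite_subset)
    moreover have "PiE S X \<inter> P S = P S" using PS[OF S] by auto
    ultimately show "(\<Sum>x\<in>PiE S X. G S x) = real (card (P S))"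
      by (simp add: G_def sum.If_cases Int_def[symmetric] flip: Collect_mem_eq)
  qed
  also have "\<dots> \<le> real c powr (1 / D * N)"
    by (rule prod_ksubsets_le) (use c in auto)
  also have "1 / D * N = m / k" using N_eq by simp
  finally have "real (card E) powr (k / m) \<le> (real c powr (m / k)) powr (k / m)"
    by (intro powr_mono2) auto
  also have "\<dots> = c" using k by (simp add: powr_powr)
  finally show ?thesis using S by (auto simp: P_def)
qed

lemma rank_weighted_sum_le:
  assumes \<rho>: "bij_betw \<rho> (PiE M X) {1..card (PiE M X)}"
  shows "(\<Sum>i\<in>PiE M X. f i powr (2 * real k / (real k + 1)) * real (\<rho> i) powr ((real k / real m - 1) / (real k + 1)))
    \<le> (\<Sum>S\<in>ksubsets k M. block_sum (2 * real k / (real k + 1)) M X f S) * (real m / real k) powr (1 / (real k + 1))"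
proof -
  define \<theta> where "\<theta> = real k / (real k + 1)"
  have \<theta>: "0 < \<theta>" "\<theta> \<le> 1" "1 - \<theta> = 1 / (real k + 1)" using k by (auto simp: \<theta>_def field_simps)
  \<comment> \<open>Chosen so that \<open>w i powr (1 - \<theta>)\<close> is the rank weight of the
    statement, while the exponent \<open>\<theta>\<close> turns the square of \<open>f i\<close>
    into the required power.\<close>
  define w where "w i = real (\<rho> i) powr (k / m - 1)" for i
  have w0: "w i \<ge> 0" for i by (simp add: w_def)
  have km: "0 < real k / m" "real k / m \<le> 1" using k by auto
  have "\<exists>\<tau>. (\<forall>i\<in>PiE M X. \<tau> i \<in> ksubsets k M) \<and> (\<forall>S\<in>ksubsets k M. \<forall>x.
      (\<Sum>i\<in>{i\<in>PiE M X. \<tau> i = S \<and> restrict i S = x}. w i) \<le> m / k)"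
  \<comment> \<open>The mass of \<open>E\<close> is largest when \<open>E\<close> carries the first
    \<open>card E\<close> ranks; the power sum is then at most \<open>m / k\<close> times
    \<open>card E\<close> to the power \<open>k / m\<close>, and some projection is at least as
    large as that power.\<close>
  proof (rule greedy_assignment[OF fin])
    fix E assume E: "E \<subseteq> PiE M X" "E \<noteq> {}"
    then obtain S where S: "S\<in>ksubsets k M" "real (card E) powr (k / m) \<le> card ((\<lambda>i. restrict i S) ` E)"
      using card_powr_le_projection by blast
    have inj: "inj_on \<rho> E" using \<rho> E by (auto simp: bij_betw_def intro: inj_on_subset)
    have "(\<Sum>i\<in>E. w i) = (\<Sum>l\<in>\<rho> ` E. real l powr (k / m - 1))"
      by (simp add: sum.reindex[OF inj] w_def)
    also have "\<dots> \<le> (\<Sum>l=1..card (\<rho> ` E). real l powr (k / m - 1))"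
    proof (rule sum_antimono_le_initial)
      show "finite (\<rho> ` E)" using E fin finite_subset by blast
      show "\<rho> ` E \<subseteq> {1..}" using E bij_betwE[OF \<rho>] by auto
    qed (use km in \<open>auto intro!: powr_mono2'\<close>)
    also have "\<dots> \<le> real (card E) powr (k / m) / (k / m)"
      unfolding card_image[OF inj] by (rule sum_powr_le[OF km])
    also have "\<dots> \<le> card ((\<lambda>i. restrict i S) ` E) / (k / m)"
      using S km by (intro divide_right_mono) auto
    finally show "\<exists>S\<in>ksubsets k M. (\<Sum>i\<in>E. w i) \<le> m / k * card ((\<lambda>i. restrict i S) ` E)"
      using S by (auto simp: field_simps)
  qed (use w0 in auto)
  then obtain \<tau> where \<tau>: "\<forall>i\<in>PiE M X. \<tau> i \<in> ksubsets k M"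
    and \<tau>w: "\<And>S x. S\<in>ksubsets k M \<Longrightarrow> (\<Sum>i\<in>{i\<in>PiE M X. \<tau> i = S \<and> restrict i S = x}. w i) \<le> m / k"
    by blast
  define h where "h i = (f i)\<^sup>2 powr \<theta> * w i powr (1 - \<theta>)" for i
  have h: "f i powr (2 * real k / (real k + 1)) * real (\<rho> i) powr ((real k / real m - 1) / (real k + 1)) = h i" for i
  proof -
    have "(f i)\<^sup>2 powr \<theta> = f i powr (2 * real k / (real k + 1))"
      using f0[of i] by (cases "f i = 0") (auto simp: \<theta>_def powr_powr add.commute simp flip: powr_numeral)
    then show ?thesis by (simp add: h_def w_def powr_powr \<theta>(3) add.commute)
  qed
  have h0: "h i \<ge> 0" for i by (simp add: h_def)
  have cell: "(\<Sum>i\<in>{i\<in>PiE M X. \<tau> i = S \<and> restrict i S = x}. h i)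
      \<le> cell_mass M X f S x powr \<theta> * (real m / real k) powr (1 - \<theta>)" if "S \<in> ksubsets k M" for S x
  proof -
    have "(\<Sum>i\<in>{i\<in>PiE M X. \<tau> i = S \<and> restrict i S = x}. h i) \<le>
      (\<Sum>i\<in>{i\<in>PiE M X. \<tau> i = S \<and> restrict i S = x}. (f i)\<^sup>2) powr \<theta> *
      (\<Sum>i\<in>{i\<in>PiE M X. \<tau> i = S \<and> restrict i S = x}. w i) powr (1 - \<theta>)"
      unfolding h_def using fin \<theta> w0 by (intro holder_two) auto
    \<comment> \<open>The cell is part of the whole fibre over \<open>x\<close>, so its squares sum
      to at most \<open>cell_mass\<close>; the assignment bounds its \<open>w\<close>-mass.\<close>
    also have "\<dots> \<le> cell_mass M X f S x powr \<theta> * (real m / real k) powr (1 - \<theta>)"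
      unfolding cell_mass_def using fin \<theta> w0 \<tau>w[OF that]
      by (intro mult_mono powr_mono2 sum_mono2 sum_nonneg) auto
    finally show ?thesis .
  qed
  have "(\<Sum>i\<in>PiE M X. h i) = (\<Sum>S\<in>ksubsets k M. \<Sum>i\<in>{i\<in>PiE M X. \<tau> i = S}. h i)"
    using fin finM \<tau> by (subst sum.group) auto
  also have "\<dots> = (\<Sum>S\<in>ksubsets k M. \<Sum>x\<in>PiE S X. \<Sum>i\<in>{i\<in>PiE M X. \<tau> i = S \<and> restrict i S = x}. h i)"
  proof (rule sum.cong[OF refl])
    fix S assume S: "S \<in> ksubsets k M"
    have "finite (PiE S X)" using subsetD'[OF S] finM finX by (intro finite_PiE) (auto intro: finite_subset)
    then have "(\<Sum>x\<in>PiE S X. \<Sum>i\<in>{i\<in>{i\<in>PiE M X. \<tau> i = S}. restrict i S = x}. h i) = (\<Sum>i\<in>{i\<in>PiE M X. \<tau> i = S}. h i)"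
      using fin restrict_image_PiE[OF subsetD'[OF S], of X] by (intro sum.group) auto
    then show "(\<Sum>i\<in>{i\<in>PiE M X. \<tau> i = S}. h i) = (\<Sum>x\<in>PiE S X. \<Sum>i\<in>{i\<in>PiE M X. \<tau> i = S \<and> restrict i S = x}. h i)"
      by (simp add: conj_assoc)
  qed
  also have "\<dots> \<le> (\<Sum>S\<in>ksubsets k M. \<Sum>x\<in>PiE S X. cell_mass M X f S x powr \<theta> * (real m / real k) powr (1 - \<theta>))"
    by (intro sum_mono cell)
  also have "\<dots> = (\<Sum>S\<in>ksubsets k M. block_sum (2 * real k / (real k + 1)) M X f S) * (real m / real k) powr (1 / (real k + 1))"
  proof -
    have "2 * real k / (real k + 1) / 2 = \<theta>" by (simp add: \<theta>_def divide_simps)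
    then have "block_sum (2 * real k / (real k + 1)) M X f S = (\<Sum>x\<in>PiE S X. cell_mass M X f S x powr \<theta>)" for S
      unfolding block_sum_def by (simp only:)
    then show ?thesis unfolding \<theta>(3) by (simp only: sum_distrib_right of_nat_add of_nat_1)
  qed
  finally show ?thesis by (simp only: h)
qed

text \<open>An auxiliary product \<open>H\<close> of fibre norms is inserted and cancelled again.
  Shearer's inequality bounds the sum of \<open>H\<close>, Hoelder's inequality over the
  \<open>N\<close> subsets bounds the sum of the square of \<open>f\<close> times
  \<open>H powr (- 1 / m)\<close>, and a second Hoelder step with
  \<open>\<theta> = m / (m + 1)\<close> combines the two.\<close>

lemma blei:
  assumes K: "\<And>S. S \<in> ksubsets k M \<Longrightarrow> block_sum (2 * real k / (real k + 1)) M X f S \<le> K" "K \<ge> 0"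
  shows "(\<Sum>i\<in>PiE M X. f i powr (2 * real m / (real m + 1))) \<le> K powr ((real m / (real m + 1)) * ((real k + 1) / real k))"
proof -
  define V where "V = cell_mass M X f"
  define q where "q = 2 * real k / (real k + 1)"
  define \<theta> where "\<theta> = real m / (real m + 1)"
  have \<theta>: "0 < \<theta>" "\<theta> \<le> 1" "1 - \<theta> = 1 / (real m + 1)" using k by (auto simp: \<theta>_def field_simps)
  have q: "0 < q" "q < 2" using k by (auto simp: q_def field_simps)
  define H where "H i = (\<Prod>S\<in>ksubsets k M. (V S (restrict i S) powr (q / 2)) powr (1 / D))" for i
  have H0: "H i \<ge> 0" for i by (auto simp: H_def intro!: prod_nonneg)
  have T: "(\<Sum>x\<in>PiE S X. V S x powr (q / 2)) = block_sum (2 * real k / (real k + 1)) M X f S" for S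
    by (simp add: block_sum_def V_def q_def add.commute)
  have Vpos: "V S (restrict i S) > 0" if "f i > 0" "i \<in> PiE M X" for i S
    unfolding V_def cell_mass_def using that fin by (intro sum_pos2[of _ i]) auto
  have "(\<Sum>i\<in>PiE M X. H i) \<le> (\<Prod>S\<in>ksubsets k M. (\<Sum>x\<in>PiE S X. V S x powr (q / 2)) powr (1 / D))"
    unfolding H_def by (rule shearer_ksubsets) auto
  also have "\<dots> \<le> K powr (1 / D * N)"
    by (rule prod_ksubsets_le) (use K in \<open>auto simp: T\<close>)
  also have "1 / D * N = m / k" using N_eq by simp
  finally have sumH: "(\<Sum>i\<in>PiE M X. H i) \<le> K powr (m / k)" .

  \<comment> \<open>\<open>g S\<close> distributes \<open>V S x powr (q / 2)\<close> over the fibre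
    of \<open>x\<close> in proportion to the squares of \<open>f\<close>, so its total is the block
    sum of \<open>S\<close>. A fibre of mass zero causes no trouble, since
    \<open>0 powr (q / 2 - 1) = 0\<close>.\<close>
  define g where "g S i = (f i)\<^sup>2 * V S (restrict i S) powr (q / 2 - 1)" for S i
  have g0: "g S i \<ge> 0" for S i by (simp add: g_def)
  have g: "(f i)\<^sup>2 * H i powr (- 1 / m) = (\<Prod>S\<in>ksubsets k M. g S i powr (1 / N))"
    if i: "i \<in> PiE M X" for i
  proof (cases "f i = 0")
    case True
    then have "(\<Prod>S\<in>ksubsets k M. g S i powr (1 / N)) = 0"
      using ksubsets_nonempty finM by (simp add: g_def card_gt_0_iff)
    with True show ?thesis by simp
  next
    case False
    then have pos: "f i > 0" using f0[of i] by simp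
    \<comment> \<open>This matching of exponents is what \<open>q = 2 * k / (k + 1)\<close>
      achieves: \<open>1 - q / 2\<close> equals \<open>q / 2\<close> divided by
      \<open>k\<close>.\<close>
    have e: "q / 2 * (1 / D) * (- 1 / m) = (q / 2 - 1) * (1 / N)"
    proof -
      have "real D = N * k / m" using N_eq D_pos k N_pos by (simp add: field_simps)
      then have "q / 2 * (1 / D) = q / 2 * m / (N * k)" using k N_pos by simp
      moreover have "q / 2 - 1 = - (q / 2 / k)" using k by (simp add: q_def divide_simps)
      ultimately show ?thesis using k by simp
    qed
    have "H i powr (- 1 / m) = (\<Prod>S\<in>ksubsets k M. ((V S (restrict i S) powr (q / 2)) powr (1 / D)) powr (- 1 / m))"
      unfolding H_def by (rule prod_powr_distrib)
    also have "\<dots> = (\<Prod>S\<in>ksubsets k M. (V S (restrict i S) powr (q / 2 - 1)) powr (1 / N))"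
      using e by (simp add: powr_powr)
    finally have 1: "H i powr (- 1 / m) = \<dots>" .
    have "(f i)\<^sup>2 = (\<Prod>S\<in>ksubsets k M. (f i)\<^sup>2 powr (1 / N))"
      using powr_realpow[of "(f i)\<^sup>2 powr (1 / N)" "card (ksubsets k M)"] N_pos pos
      by (simp add: card_N powr_powr)
    with 1 have "(f i)\<^sup>2 * H i powr (- 1 / m)
      = (\<Prod>S\<in>ksubsets k M. (f i)\<^sup>2 powr (1 / N) * (V S (restrict i S) powr (q / 2 - 1)) powr (1 / N))"
      by (simp add: prod.distrib)
    then show ?thesis by (simp add: g_def powr_mult)
  qed
  have sumg: "(\<Sum>i\<in>PiE M X. g S i) = block_sum (2 * real k / (real k + 1)) M X f S" if S: "S \<in> ksubsets k M" for S
  proof -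
    have "finite (PiE S X)" using subsetD'[OF S] finM finX by (intro finite_PiE) (auto intro: finite_subset)
    then have "(\<Sum>i\<in>PiE M X. g S i) = (\<Sum>x\<in>PiE S X. \<Sum>i\<in>{i\<in>PiE M X. restrict i S = x}. g S i)"
      using fin restrict_image_PiE[OF subsetD'[OF S], of X] by (intro sum.group[symmetric]) auto
    also have "\<dots> = (\<Sum>x\<in>PiE S X. V S x * V S x powr (q / 2 - 1))"
      unfolding V_def cell_mass_def sum_distrib_right
      by (intro sum.cong refl) (auto simp: g_def V_def cell_mass_def)
    also have "\<dots> = (\<Sum>x\<in>PiE S X. V S x powr (q / 2))"
      by (intro sum.cong refl) (auto simp: powr_diff V_def)
    finally show ?thesis by (simp add: T)
  qed
  have "(\<Sum>i\<in>PiE M X. (f i)\<^sup>2 * H i powr (- 1 / m)) = (\<Sum>i\<in>PiE M X. \<Prod>S\<in>ksubsets k M. g S i powr (1 / N))"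
    by (intro sum.cong refl g)
  also have "\<dots> \<le> (\<Prod>S\<in>ksubsets k M. (\<Sum>i\<in>PiE M X. g S i) powr (1 / N))"
    using finM fin N_pos g0 card_ksubsets[OF finM, of k] cardM
    by (intro holder_prod) (auto simp: N_def)
  also have "\<dots> \<le> K powr (1 / N * N)"
    using K N_pos by (intro prod_ksubsets_le) (auto simp: sumg)
  finally have sumfH: "(\<Sum>i\<in>PiE M X. (f i)\<^sup>2 * H i powr (- 1 / m)) \<le> K"
    using N_pos K by simp

  have "f i powr (2 * real m / (real m + 1)) = ((f i)\<^sup>2 * H i powr (- 1 / m)) powr \<theta> * H i powr (1 - \<theta>)"
    if i: "i \<in> PiE M X" for i
  proof (cases "f i = 0")
    case False
    then have pos: "f i > 0" using f0[of i] by simp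
    have Hpos: "H i > 0" unfolding H_def using Vpos[OF pos i] by (intro prod_pos) (auto simp: less_imp_neq[symmetric])
    \<comment> \<open>The total exponent of \<open>H\<close> vanishes; since \<open>H i > 0\<close>
      wherever \<open>f i > 0\<close>, the factor is really 1.\<close>
    have "- 1 / m * \<theta> + (1 - \<theta>) = 0" using k by (simp add: \<theta>(3)) (simp add: \<theta>_def field_simps add_nonneg_eq_0_iff)
    then have "(H i powr (- 1 / m)) powr \<theta> * H i powr (1 - \<theta>) = 1"
      using Hpos by (simp add: powr_powr powr_add[symmetric])
    moreover have "(f i)\<^sup>2 powr \<theta> = f i powr (2 * real m / (real m + 1))"
      using pos by (simp add: \<theta>_def powr_powr add.commute flip: powr_numeral)
    ultimately show ?thesis by (simp add: powr_mult mult.assoc)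
  qed simp
  then have "(\<Sum>i\<in>PiE M X. f i powr (2 * real m / (real m + 1)))
     = (\<Sum>i\<in>PiE M X. ((f i)\<^sup>2 * H i powr (- 1 / m)) powr \<theta> * H i powr (1 - \<theta>))"
    by (intro sum.cong refl)
  also have "\<dots> \<le> (\<Sum>i\<in>PiE M X. (f i)\<^sup>2 * H i powr (- 1 / m)) powr \<theta> * (\<Sum>i\<in>PiE M X. H i) powr (1 - \<theta>)"
    using fin \<theta> H0 by (intro holder_two) auto
  also have "\<dots> \<le> K powr \<theta> * (K powr (m / k)) powr (1 - \<theta>)"
    using sumfH sumH \<theta> H0 by (intro mult_mono powr_mono2) (auto intro!: sum_nonneg)
  also have "\<dots> = K powr (\<theta> + m / k * (1 - \<theta>))"
    by (simp add: powr_powr powr_add)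
  also have "\<theta> + m / k * (1 - \<theta>) = (real m / (real m + 1)) * ((real k + 1) / real k)"
    using k by (simp add: \<theta>(3)) (simp add: \<theta>_def field_simps add_nonneg_eq_0_iff)
  finally show ?thesis .
qed

end

section \<open>The Khinchine-Steinhaus inequality\<close>

definition torus1 :: "real measure" where
  "torus1 = restrict_space lborel {0..1}"

lemma torus1_prob: "prob_space torus1"
  unfolding torus1_def by (rule prob_spaceI) (simp add: space_restrict_space emeasure_restrict_space)

interpretation torus1: prob_space torus1 by (rule torus1_prob)

interpretation tprod: product_prob_space "\<lambda>_::nat. torus1" UNIV
  by (intro product_prob_spaceI torus1_prob)

lemma torus_param_eq: "torus_param N = PiM {..<N} (\<lambda>_. torus1)"
  by (simp add: torus_param_def torus1_def)

lemma torus_param_prob: "prob_space (torus_param N)"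
  unfolding torus_param_eq by (rule prob_space_PiM) (rule torus1_prob)

lemma circ_measurable [measurable]: "circ \<in> borel_measurable borel"
  unfolding circ_def by (intro borel_measurable_continuous_onI continuous_intros)

lemma circ_measurable_torus1 [measurable]: "circ \<in> borel_measurable torus1"
  unfolding torus1_def by (intro measurable_restrict_space1) simp

lemma norm_circ [simp]: "cmod (circ t) = 1"
  by (simp add: circ_def)

lemma circ_component_measurable [measurable]:
  "k < N \<Longrightarrow> (\<lambda>t. circ (t k)) \<in> borel_measurable (torus_param N)"
  unfolding torus_param_eq by measurable

lemma steinhaus_measurable [measurable]:
  "(\<lambda>t. \<Sum>k<N. \<alpha> k * circ (t k)) \<in> borel_measurable (torus_param N)"
  by (intro borel_measurable_sum borel_measurable_times) auto

lemma norm_steinhaus_le: "cmod (\<Sum>k<N. \<alpha> k * circ (t k)) \<le> (\<Sum>k<N. cmod (\<alpha> k))"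
  by (rule order.trans[OF norm_sum]) (simp add: norm_mult)

text \<open>By the fundamental theorem of calculus with the explicit primitive \<open>F\<close>.
  Frequency 1 serves for the real part of a rotating vector, frequency 2 for its square.\<close>

lemma integral_torus1_trig:
  assumes "n \<ge> (1::nat)"
  shows "(\<integral>t. c + a * cos (2 * pi * n * t) + b * sin (2 * pi * n * t) \<partial>torus1) = c"
proof -
  define F where "F t = c * t + a * sin (2 * pi * n * t) / (2 * pi * n) - b * cos (2 * pi * n * t) / (2 * pi * n)" for t
  have "(\<integral>t. c + a * cos (2 * pi * n * t) + b * sin (2 * pi * n * t) \<partial>torus1)
     = (\<integral>t. (c + a * cos (2 * pi * n * t) + b * sin (2 * pi * n * t)) * indicator {0..1} t \<partial>lborel)"
    unfolding torus1_def by (subst integral_restrict_space) (auto simp: mult.commute)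
  also have "\<dots> = F 1 - F 0"
  proof (rule integral_FTC_Icc_real)
    fix t :: real
    show "DERIV F t :> c + a * cos (2 * pi * n * t) + b * sin (2 * pi * n * t)"
      unfolding F_def using assms by (auto intro!: derivative_eq_intros)
  qed (auto intro!: continuous_intros)
  also have "\<dots> = c"
    using cos_int_2pin[of "int n"] sin_int_2pin[of "int n"] by (simp add: F_def)
  finally show ?thesis .
qed

lemma integral_Re_circ: "(\<integral>t. Re (w * circ t) \<partial>torus1) = 0"
  using integral_torus1_trig[of 1 0 "Re w" "- Im w"] by (simp add: circ_def)

lemma integral_Re_circ_sq: "(\<integral>t. (Re (w * circ t))\<^sup>2 \<partial>torus1) = (cmod w)\<^sup>2 / 2"
proof -
  have "(Re (w * circ t))\<^sup>2 = (cmod w)\<^sup>2 / 2 + ((Re w)\<^sup>2 - (Im w)\<^sup>2) / 2 * cos (2 * pi * real 2 * t)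
      + (- Re w * Im w) * sin (2 * pi * real 2 * t)" for t
  proof -
    have c: "cos (2 * pi * real 2 * t) = 2 * (cos (2 * pi * t))\<^sup>2 - 1"
      and s: "sin (2 * pi * real 2 * t) = 2 * sin (2 * pi * t) * cos (2 * pi * t)"
      using cos_double_cos[of "2 * pi * t"] sin_double[of "2 * pi * t"] by (simp_all add: mult_ac)
    have "(Re (w * circ t))\<^sup>2 = (Re w * cos (2 * pi * t) - Im w * sin (2 * pi * t))\<^sup>2"
      by (simp add: circ_def)
    also have "\<dots> = (Re w)\<^sup>2 * (cos (2 * pi * t))\<^sup>2 + (Im w)\<^sup>2 * (1 - (cos (2 * pi * t))\<^sup>2)
        - 2 * Re w * Im w * cos (2 * pi * t) * sin (2 * pi * t)"
      unfolding sin_squared_eq[symmetric] by (simp add: power2_eq_square algebra_simps)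
    finally show ?thesis unfolding c s cmod_power2 by (simp add: field_simps)
  qed
  then show ?thesis
    using integral_torus1_trig[of 2 "(cmod w)\<^sup>2 / 2" "((Re w)\<^sup>2 - (Im w)\<^sup>2) / 2" "- Re w * Im w"] by simp
qed

lemma integrable_Re_circ: "integrable torus1 (\<lambda>t. Re (w * circ t) ^ r)"
proof (rule torus1.integrable_const_bound[where B = "cmod w ^ r"])
  have "\<bar>Re (w * circ t)\<bar> \<le> cmod w" for t
    using abs_Re_le_cmod[of "w * circ t"] by (simp add: norm_mult)
  then show "AE t in torus1. norm (Re (w * circ t) ^ r) \<le> cmod w ^ r"
    by (auto simp: power_abs intro!: power_mono)
qed auto

lemma norm_add_circ_sq:
  "(cmod (g + \<alpha> * circ t))\<^sup>2 = (cmod g)\<^sup>2 + (cmod \<alpha>)\<^sup>2 + 2 * Re (cnj g * \<alpha> * circ t)"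
proof -
  have "(cmod (\<alpha> * circ t))\<^sup>2 = (cmod \<alpha>)\<^sup>2" by (simp add: norm_mult)
  moreover have "(cmod (g + v))\<^sup>2 = (cmod g)\<^sup>2 + (cmod v)\<^sup>2 + 2 * Re (cnj g * v)" for v
    unfolding cmod_power2 by (simp add: power2_eq_square algebra_simps)
  ultimately show ?thesis by (simp add: mult.assoc)
qed

lemma integral_norm_add_circ_2:
  "(\<integral>t. (cmod (g + \<alpha> * circ t))\<^sup>2 \<partial>torus1) = (cmod g)\<^sup>2 + (cmod \<alpha>)\<^sup>2"
  unfolding norm_add_circ_sq
  using integrable_Re_circ[of "cnj g * \<alpha>" 1] torus1.prob_space
  by (simp add: integral_Re_circ del: times_complex.sel)

text \<open>Square the expansion of the squared modulus: the linear term in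
  \<open>Re (w * circ t)\<close> has mean zero and the quadratic one has mean half the square of
  \<open>cmod w\<close>.\<close>

lemma integral_norm_add_circ_4:
  "(\<integral>t. (cmod (g + \<alpha> * circ t)) ^ 4 \<partial>torus1) = (cmod g) ^ 4 + (cmod \<alpha>) ^ 4 + 4 * (cmod g)\<^sup>2 * (cmod \<alpha>)\<^sup>2"
proof -
  define S where "S = (cmod g)\<^sup>2 + (cmod \<alpha>)\<^sup>2"
  define w where "w = cnj g * \<alpha>"
  have "(cmod (g + \<alpha> * circ t)) ^ 4 = S\<^sup>2 + 4 * S * Re (w * circ t) + 4 * (Re (w * circ t))\<^sup>2" for t
  proof -
    have "(cmod (g + \<alpha> * circ t)) ^ 4 = (S + 2 * Re (w * circ t))\<^sup>2"
      unfolding S_def w_def norm_add_circ_sq[symmetric] by simp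
    then show ?thesis by (simp add: power2_eq_square algebra_simps)
  qed
  then have "(\<integral>t. (cmod (g + \<alpha> * circ t)) ^ 4 \<partial>torus1) = S\<^sup>2 + 2 * (cmod w)\<^sup>2"
    using integrable_Re_circ[of w 1] integrable_Re_circ[of w 2] torus1.prob_space
    by (simp add: integral_Re_circ integral_Re_circ_sq del: times_complex.sel)
  then show ?thesis
    by (simp add: S_def w_def norm_mult power2_eq_square power4_eq_xxxx algebra_simps)
qed

lemma steinhaus_integrable:
  "integrable (torus_param N) (\<lambda>t. cmod (\<Sum>k<N. \<alpha> k * circ (t k)) ^ r)"
proof -
  interpret prob_space "torus_param N" by (rule torus_param_prob)
  have "cmod (\<Sum>k<N. \<alpha> k * circ (t k)) ^ r \<le> (\<Sum>k<N. cmod (\<alpha> k)) ^ r" for t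
    by (intro power_mono norm_steinhaus_le) auto
  then show ?thesis
    by (intro integrable_const_bound[where B = "(\<Sum>k<N. cmod (\<alpha> k)) ^ r"]) auto
qed

lemma steinhaus_integrable_powr:
  assumes "p \<ge> 0"
  shows "integrable (torus_param N) (\<lambda>t. cmod (\<Sum>k<N. \<alpha> k * circ (t k)) powr p)"
proof -
  interpret prob_space "torus_param N" by (rule torus_param_prob)
  have "cmod (\<Sum>k<N. \<alpha> k * circ (t k)) powr p \<le> (\<Sum>k<N. cmod (\<alpha> k)) powr p" for t
    using assms by (intro powr_mono2 norm_steinhaus_le) auto
  then show ?thesis
    by (intro integrable_const_bound[where B = "(\<Sum>k<N. cmod (\<alpha> k)) powr p"]) auto
qed

text \<open>Fubini's theorem splits off the last variable, so that moments follow by induction from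
  the one-variable formulas with the partial sum as the constant \<open>g\<close>.\<close>

lemma steinhaus_Suc:
  "(\<integral>t. cmod (\<Sum>k<Suc N. \<alpha> k * circ (t k)) ^ r \<partial>torus_param (Suc N))
    = (\<integral>t. (\<integral>s. cmod ((\<Sum>k<N. \<alpha> k * circ (t k)) + \<alpha> N * circ s) ^ r \<partial>torus1) \<partial>torus_param N)"
proof -
  have "(\<integral>t. cmod (\<Sum>k<Suc N. \<alpha> k * circ (t k)) ^ r \<partial>torus_param (Suc N))
    = (\<integral>t. (\<integral>s. cmod (\<Sum>k<Suc N. \<alpha> k * circ ((t(N := s)) k)) ^ r \<partial>torus1) \<partial>torus_param N)"
    using tprod.product_integral_insert[of "{..<N}" N "\<lambda>t. cmod (\<Sum>k<Suc N. \<alpha> k * circ (t k)) ^ r"]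
      steinhaus_integrable[of "Suc N" \<alpha> r]
    unfolding torus_param_eq lessThan_Suc by simp
  then show ?thesis by simp
qed

lemma steinhaus_second_moment:
  "(\<integral>t. cmod (\<Sum>k<N. \<alpha> k * circ (t k)) ^ 2 \<partial>torus_param N) = (\<Sum>k<N. (cmod (\<alpha> k))\<^sup>2)"
proof (induction N)
  case 0
  show ?case by simp
next
  case (Suc N)
  interpret prob_space "torus_param N" by (rule torus_param_prob)
  show ?case
    unfolding steinhaus_Suc integral_norm_add_circ_2
    using Suc steinhaus_integrable[of N \<alpha> 2] prob_space by simp
qed

lemma steinhaus_fourth_moment:
  "(\<integral>t. cmod (\<Sum>k<N. \<alpha> k * circ (t k)) ^ 4 \<partial>torus_param N) \<le> 2 * (\<Sum>k<N. (cmod (\<alpha> k))\<^sup>2)\<^sup>2"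
proof (induction N)
  case 0
  show ?case by simp
next
  case (Suc N)
  interpret prob_space "torus_param N" by (rule torus_param_prob)
  define s where "s = (\<Sum>k<N. (cmod (\<alpha> k))\<^sup>2)"
  define c where "c = (cmod (\<alpha> N))\<^sup>2"
  have "(\<integral>t. cmod (\<Sum>k<Suc N. \<alpha> k * circ (t k)) ^ 4 \<partial>torus_param (Suc N))
     = (\<integral>t. cmod (\<Sum>k<N. \<alpha> k * circ (t k)) ^ 4 \<partial>torus_param N) + c\<^sup>2 + 4 * s * c"
    unfolding steinhaus_Suc integral_norm_add_circ_4 s_def c_def
    using steinhaus_integrable[of N \<alpha> 4] steinhaus_integrable[of N \<alpha> 2] prob_space
    by (simp add: steinhaus_second_moment)
  also have "\<dots> \<le> 2 * s\<^sup>2 + c\<^sup>2 + 4 * s * c" using Suc by (simp add: s_def)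
  \<comment> \<open>The right-hand side exceeds the left by one further square of \<open>c\<close>;
    this is why the factor 2 reproduces itself.\<close>
  also have "\<dots> \<le> 2 * (s + c)\<^sup>2" by (simp add: power2_eq_square algebra_simps)
  finally show ?case by (simp add: s_def c_def)
qed

text \<open>The admissible constants, separated from their infimum \<open>KS_const\<close>, so that
  the estimates can be carried out with real numbers.\<close>

definition KS_valid :: "real \<Rightarrow> real \<Rightarrow> bool" where
  "KS_valid p A \<longleftrightarrow> A \<ge> 1 \<and> (\<forall>N (\<alpha> :: nat \<Rightarrow> complex).
          sqrt (\<Sum>k<N. (cmod (\<alpha> k))\<^sup>2)
            \<le> A * (\<integral>t. cmod (\<Sum>k<N. \<alpha> k * circ (t k)) powr p \<partial>torus_param N) powr (1 / p))"

text \<open>Littlewood's interpolation of the second moment between the \<open>p\<close>-th and the fourth moment.\<close>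

lemma steinhaus_khinchine:
  assumes p: "1 \<le> p" "p < 2"
  shows "sqrt (\<Sum>k<N. (cmod (\<alpha> k))\<^sup>2)
    \<le> 2 powr (1 / p - 1 / 2) * (\<integral>t. cmod (\<Sum>k<N. \<alpha> k * circ (t k)) powr p \<partial>torus_param N) powr (1 / p)"
proof -
  interpret prob_space "torus_param N" by (rule torus_param_prob)
  define f where "f t = cmod (\<Sum>k<N. \<alpha> k * circ (t k))" for t
  define s where "s = (\<Sum>k<N. (cmod (\<alpha> k))\<^sup>2)"
  define U where "U = (\<integral>t. f t powr p \<partial>torus_param N)"
  define W where "W = (\<integral>t. f t ^ 4 \<partial>torus_param N)"
  \<comment> \<open>The interpolation parameter solves
    \<open>p * \<theta> + 4 * (1 - \<theta>) = 2\<close>.\<close>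
  define \<theta> where "\<theta> = 2 / (4 - p)"
  have "\<theta> * d = 2" if "d > 0" "d = 4 - p" for d
    unfolding \<theta>_def that(2)[symmetric] using that(1) by simp
  from this[of "4 - p"] p have "\<theta> * (4 - p) = 2" by simp
  then have \<theta>_eq: "p * \<theta> + 4 * (1 - \<theta>) = 2" by (simp add: algebra_simps)
  have \<theta>: "0 < \<theta>" "\<theta> < 1" using p by (auto simp: \<theta>_def)
  have p\<theta>_eq: "p * \<theta> = 2 * (2 * \<theta> - 1)" using \<theta>_eq by simp
  have p\<theta>: "2 * \<theta> - 1 > 0" using p\<theta>_eq p \<theta> by (metis mult_pos_pos zero_less_mult_pos zero_less_numeral less_le_trans zero_less_one)
  have f0: "f t \<ge> 0" for t by (simp add: f_def)
  have m2: "(\<integral>t. f t ^ 2 \<partial>torus_param N) = s" unfolding f_def s_def by (rule steinhaus_second_moment)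
  have W: "W \<le> 2 * s\<^sup>2" unfolding W_def f_def s_def by (rule steinhaus_fourth_moment)
  have i2: "integrable (torus_param N) (\<lambda>t. f t ^ 2)" and i4: "integrable (torus_param N) (\<lambda>t. f t ^ 4)"
    unfolding f_def by (rule steinhaus_integrable)+
  have ip: "integrable (torus_param N) (\<lambda>t. f t powr p)"
    unfolding f_def using p by (intro steinhaus_integrable_powr) auto
  have s0: "s \<ge> 0" unfolding s_def by (intro sum_nonneg) auto
  have U0: "U \<ge> 0" unfolding U_def using f0 by (auto intro!: integral_nonneg)
  have f_le: "f t ^ 2 = (f t powr p) powr \<theta> * (f t ^ 4) powr (1 - \<theta>)" for t
  proof (cases "f t = 0")
    case False
    then have "f t > 0" using f0[of t] by simp
    then have "(f t powr p) powr \<theta> * (f t ^ 4) powr (1 - \<theta>) = f t powr (p * \<theta> + 4 * (1 - \<theta>))"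
      by (simp add: powr_powr powr_add flip: powr_numeral)
    then show ?thesis unfolding \<theta>_eq using \<open>f t > 0\<close> by simp
  qed simp
  \<comment> \<open>Hoelder's inequality for the integrals is obtained from Young's inequality at
    each point, with scaling constants \<open>u\<close> and \<open>w\<close> left free. They become
    \<open>U\<close> and the bound \<open>2 * s\<^sup>2\<close> for \<open>W\<close>, which is
    visibly positive.\<close>
  have young: "f t ^ 2 \<le> u powr \<theta> * w powr (1 - \<theta>) * (\<theta> * (f t powr p / u) + (1 - \<theta>) * (f t ^ 4 / w))"
    if "u > 0" "w > 0" for u w t
  proof -
    have "(f t powr p / u) powr \<theta> * (f t ^ 4 / w) powr (1 - \<theta>) \<le> \<theta> * (f t powr p / u) + (1 - \<theta>) * (f t ^ 4 / w)"
    proof (cases "f t = 0")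
      case True then show ?thesis by simp
    next
      case False
      then show ?thesis using f0[of t] that \<theta> by (intro Youngs_inequality_0) auto
    qed
    moreover have "f t ^ 2 = u powr \<theta> * w powr (1 - \<theta>) * ((f t powr p / u) powr \<theta> * (f t ^ 4 / w) powr (1 - \<theta>))"
      unfolding f_le using that f0[of t] by (simp add: powr_divide)
    ultimately show ?thesis using that by (simp add: mult_left_mono)
  qed
  have main: "s \<le> u powr \<theta> * w powr (1 - \<theta>) * (\<theta> * (U / u) + (1 - \<theta>) * (W / w))" if "u > 0" "w > 0" for u w
  proof -
    have "s \<le> (\<integral>t. u powr \<theta> * w powr (1 - \<theta>) * (\<theta> * (f t powr p / u) + (1 - \<theta>) * (f t ^ 4 / w)) \<partial>torus_param N)"
      unfolding m2[symmetric] using young[OF that] i2 i4 ip by (intro integral_mono) auto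
    also have "\<dots> = u powr \<theta> * w powr (1 - \<theta>) * (\<theta> * (U / u) + (1 - \<theta>) * (W / w))"
      unfolding U_def W_def using i4 ip by simp
    finally show ?thesis .
  qed
  show ?thesis
  proof (cases "s = 0")
    case True
    then show ?thesis by (simp add: s_def[symmetric])
  next
    case False
    then have s: "s > 0" using s0 by simp
    \<comment> \<open>If \<open>U = 0\<close>, the Steinhaus sum would vanish almost everywhere,
      against its second moment \<open>s > 0\<close>.\<close>
    have Upos: "U > 0"
    proof (rule ccontr)
      assume "\<not> U > 0"
      then have U: "U = 0" using U0 by simp
      then have "AE t in torus_param N. f t powr p = 0"
        using integral_nonneg_eq_0_iff_AE[OF ip] by (simp add: U_def)
      then have "AE t in torus_param N. f t ^ 2 = 0" by eventually_elim simp
      then have "(\<integral>t. f t ^ 2 \<partial>torus_param N) = (\<integral>t. 0 \<partial>torus_param N)"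
        using i2 by (intro integral_cong_AE) auto
      then show False using s m2 by simp
    qed
    have "s \<le> U powr \<theta> * (2 * s\<^sup>2) powr (1 - \<theta>) * (\<theta> * (U / U) + (1 - \<theta>) * (W / (2 * s\<^sup>2)))"
      using main[of U "2 * s\<^sup>2"] Upos s by simp
    also have "\<dots> \<le> U powr \<theta> * (2 * s\<^sup>2) powr (1 - \<theta>) * 1"
    proof (intro mult_left_mono)
      have "(1 - \<theta>) * (W / (2 * s\<^sup>2)) \<le> (1 - \<theta>) * 1"
        using W s \<theta> by (intro mult_left_mono) auto
      then show "\<theta> * (U / U) + (1 - \<theta>) * (W / (2 * s\<^sup>2)) \<le> 1" using Upos by simp
    qed auto
    also have "\<dots> = U powr \<theta> * 2 powr (1 - \<theta>) * s powr (2 * (1 - \<theta>))"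
      using s by (simp add: powr_mult powr_powr flip: powr_numeral)
    finally have "s \<le> U powr \<theta> * 2 powr (1 - \<theta>) * s powr (2 * (1 - \<theta>))" .
    moreover have "s powr (1 - 2 * (1 - \<theta>)) * s powr (2 * (1 - \<theta>)) = s"
      unfolding powr_add[symmetric] using s by simp
    ultimately have "s powr (1 - 2 * (1 - \<theta>)) \<le> U powr \<theta> * 2 powr (1 - \<theta>)"
      using s by (metis mult_le_cancel_right_pos powr_gt_zero less_irrefl)
    \<comment> \<open>The root is chosen to leave \<open>U powr (1 / p)\<close>; because
      \<open>p * \<theta> = 2 * (2 * \<theta> - 1)\<close>, it also leaves exactly the square root
      of \<open>s\<close>.\<close>
    then have "(s powr (1 - 2 * (1 - \<theta>))) powr (1 / (p * \<theta>)) \<le> (U powr \<theta> * 2 powr (1 - \<theta>)) powr (1 / (p * \<theta>))"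
      using p \<theta> by (intro powr_mono2) auto
    moreover have "(1 - 2 * (1 - \<theta>)) * (1 / (p * \<theta>)) = 1 / 2"
    proof -
      have "1 - 2 * (1 - \<theta>) = p * \<theta> / 2" unfolding p\<theta>_eq by simp
      then show ?thesis using p \<theta> by simp
    qed
    moreover have "\<theta> * (1 / (p * \<theta>)) = 1 / p" using \<theta> by simp
    moreover have "(1 - \<theta>) * (1 / (p * \<theta>)) = 1 / p - 1 / 2"
    proof -
      have "1 / p - 1 / 2 = (\<theta> - p * \<theta> / 2) / (p * \<theta>)" using p \<theta> by (simp add: field_simps)
      also have "\<theta> - p * \<theta> / 2 = 1 - \<theta>" unfolding p\<theta>_eq by (simp add: field_simps)
      finally show ?thesis by simp
    qed
    ultimately have "s powr (1 / 2) \<le> U powr (1 / p) * 2 powr (1 / p - 1 / 2)"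
      by (simp only: powr_mult powr_powr)
    then show ?thesis using s by (simp add: U_def f_def s_def powr_half_sqrt mult.commute)
  qed
qed

lemma KS_valid_bound:
  assumes "k \<ge> (1::nat)"
  shows "KS_valid (2 * real k / (real k + 1)) (1 + 1 / real k)"
proof -
  define p where "p = 2 * real k / (real k + 1)"
  have p: "1 \<le> p" "p < 2" using assms by (auto simp: p_def field_simps)
  have e: "1 / p - 1 / 2 = 1 / (2 * real k)" using assms by (simp add: p_def field_simps)
  \<comment> \<open>Bernoulli's inequality in the shape of Young's; the result is relaxed to
    \<open>1 + 1 / k\<close>, the form that telescopes later.\<close>
  have "2 powr (1 / (2 * real k)) * 1 powr (1 - 1 / (2 * real k)) \<le> 1 / (2 * real k) * 2 + (1 - 1 / (2 * real k)) * 1"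
    using assms by (intro Youngs_inequality_0) auto
  also have "\<dots> \<le> 1 + 1 / real k" using assms by (simp add: field_simps)
  finally have A: "2 powr (1 / p - 1 / 2) \<le> 1 + 1 / real k" by (simp add: e)
  show ?thesis unfolding p_def[symmetric] KS_valid_def
  proof (intro conjI allI)
    fix N and \<alpha> :: "nat \<Rightarrow> complex"
    show "sqrt (\<Sum>k<N. (cmod (\<alpha> k))\<^sup>2)
      \<le> (1 + 1 / real k) * (\<integral>t. cmod (\<Sum>k<N. \<alpha> k * circ (t k)) powr p \<partial>torus_param N) powr (1 / p)"
      by (rule order.trans[OF steinhaus_khinchine[OF p] mult_right_mono[OF A]]) simp
  qed simp
qed

text \<open>Minkowski's inequality in \<ell> with exponent \<open>2 / q\<close> for the functions
  \<open>f j t powr q\<close>, proved by duality: the integrals \<open>U j\<close> are tested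
  against \<open>U j powr (1 / \<theta> - 1)\<close>, Hoelder's inequality is used for each
  \<open>t\<close>, and the surplus power of \<open>s\<close> is divided out.\<close>

lemma minkowski_integral_l2:
  fixes f :: "'j \<Rightarrow> 'c \<Rightarrow> real"
  assumes J: "finite J" and q: "0 < q" "q \<le> 2" and f0: "\<And>j t. f j t \<ge> 0"
    and i: "\<And>j. j \<in> J \<Longrightarrow> integrable \<mu> (\<lambda>t. f j t powr q)"
    and iJ: "integrable \<mu> (\<lambda>t. (\<Sum>j\<in>J. (f j t)\<^sup>2) powr (q / 2))"
  shows "(\<Sum>j\<in>J. (\<integral>t. f j t powr q \<partial>\<mu>) powr (2 / q)) powr (q / 2) \<le> (\<integral>t. (\<Sum>j\<in>J. (f j t)\<^sup>2) powr (q / 2) \<partial>\<mu>)"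
proof -
  define \<theta> where "\<theta> = q / 2"
  have \<theta>: "0 < \<theta>" "\<theta> \<le> 1" "2 / q = 1 / \<theta>" using q by (auto simp: \<theta>_def)
  define U where "U j = (\<integral>t. f j t powr q \<partial>\<mu>)" for j
  have U0: "U j \<ge> 0" for j by (simp add: U_def)
  define s where "s = (\<Sum>j\<in>J. U j powr (1 / \<theta>))"
  have s0: "s \<ge> 0" by (simp add: s_def sum_nonneg)
  show ?thesis
  proof (cases "s = 0")
    case True
    then show ?thesis by (simp add: s_def[symmetric] \<theta>(3) U_def[symmetric])
  next
    case False
    then have s: "s > 0" using s0 by simp
    define I where "I = (\<integral>t. (\<Sum>j\<in>J. (f j t)\<^sup>2) powr \<theta> \<partial>\<mu>)"
    have pt: "(\<Sum>j\<in>J. f j t powr q * U j powr (1 / \<theta> - 1)) \<le> (\<Sum>j\<in>J. (f j t)\<^sup>2) powr \<theta> * s powr (1 - \<theta>)" for t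
    proof -
      have "(f j t)\<^sup>2 powr \<theta> * (U j powr (1 / \<theta>)) powr (1 - \<theta>) = f j t powr q * U j powr (1 / \<theta> - 1)" for j
      proof -
        have "(f j t)\<^sup>2 powr \<theta> = f j t powr q"
          using f0[of j t] by (cases "f j t = 0") (simp_all add: \<theta>_def powr_powr flip: powr_numeral)
        moreover have "1 / \<theta> * (1 - \<theta>) = 1 / \<theta> - 1" using \<theta> by (simp add: field_simps)
        ultimately show ?thesis by (simp only: powr_powr)
      qed
      then show ?thesis
        using holder_two[OF J, of \<theta> "\<lambda>j. (f j t)\<^sup>2" "\<lambda>j. U j powr (1 / \<theta>)"] \<theta> by (simp add: s_def)
    qed
    have "U j powr (1 / \<theta>) = U j * U j powr (1 / \<theta> - 1)" for j
      using U0[of j] by (cases "U j = 0") (simp_all add: powr_diff)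
    then have "s = (\<Sum>j\<in>J. U j * U j powr (1 / \<theta> - 1))" by (simp add: s_def)
    also have "\<dots> = (\<integral>t. (\<Sum>j\<in>J. f j t powr q * U j powr (1 / \<theta> - 1)) \<partial>\<mu>)"
      unfolding U_def using i by (subst Bochner_Integration.integral_sum) auto
    also have "\<dots> \<le> (\<integral>t. (\<Sum>j\<in>J. (f j t)\<^sup>2) powr \<theta> * s powr (1 - \<theta>) \<partial>\<mu>)"
      using i iJ pt by (intro integral_mono) (auto simp: \<theta>_def)
    also have "\<dots> = I * s powr (1 - \<theta>)" by (simp add: I_def)
    finally have "s powr \<theta> \<le> I" using s by (simp add: powr_diff field_simps)
    then show ?thesis unfolding s_def I_def U_def \<theta>(3)[symmetric] unfolding \<theta>_def .
  qed
qed

section \<open>Averaging out coordinates\<close>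

text \<open>Bounded multilinear forms indexed by functions on an arbitrary coordinate set rather
  than by lists, so that single coordinates can be removed.\<close>

definition mult_bounded :: "'a set \<Rightarrow> nat \<Rightarrow> (('a \<Rightarrow> nat) \<Rightarrow> complex) \<Rightarrow> real \<Rightarrow> bool" where
  "mult_bounded M n a K \<longleftrightarrow> (\<forall>x. (\<forall>j\<in>M. \<forall>l\<in>{1..n}. cmod (x j l) \<le> 1) \<longrightarrow>
     cmod (\<Sum>i\<in>PiE M (\<lambda>_. {1..n}). a i * (\<Prod>j\<in>M. x j (i j))) \<le> K)"

text \<open>Freezing the argument in slot \<open>t\<close> at \<open>z\<close> is one particular
  choice of test vectors, so the bound \<open>K\<close> is inherited.\<close>

lemma mult_bounded_insert:
  assumes "finite M" "t \<notin> M" "mult_bounded (insert t M) n a K" "\<And>l. l \<in> {1..n} \<Longrightarrow> cmod (z l) \<le> 1"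
  shows "mult_bounded M n (\<lambda>i. \<Sum>l=1..n. a (i(t := l)) * z l) K"
  unfolding mult_bounded_def
proof (intro allI impI)
  fix x :: "'a \<Rightarrow> nat \<Rightarrow> complex" assume x: "\<forall>j\<in>M. \<forall>l\<in>{1..n}. cmod (x j l) \<le> 1"
  define x' where "x' = x(t := z)"
  have pr: "(\<Prod>j\<in>insert t M. x' j ((i(t := l)) j)) = z l * (\<Prod>j\<in>M. x j (i j))" for i l
  proof -
    have "(\<Prod>j\<in>M. x' j ((i(t := l)) j)) = (\<Prod>j\<in>M. x j (i j))"
      using assms by (intro prod.cong) (auto simp: x'_def)
    then show ?thesis using assms by (simp add: x'_def)
  qed
  have "(\<Sum>i\<in>PiE (insert t M) (\<lambda>_. {1..n}). a i * (\<Prod>j\<in>insert t M. x' j (i j)))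
     = (\<Sum>l=1..n. \<Sum>i\<in>PiE M (\<lambda>_. {1..n}). a (i(t := l)) * (z l * (\<Prod>j\<in>M. x j (i j))))"
    unfolding sum_PiE_insert[OF assms(2)] pr ..
  also have "\<dots> = (\<Sum>i\<in>PiE M (\<lambda>_. {1..n}). (\<Sum>l=1..n. a (i(t := l)) * z l) * (\<Prod>j\<in>M. x j (i j)))"
    by (subst sum.swap) (simp add: sum_distrib_right mult.assoc)
  finally have eq: "(\<Sum>i\<in>PiE (insert t M) (\<lambda>_. {1..n}). a i * (\<Prod>j\<in>insert t M. x' j (i j))) = \<dots>" .
  have "\<forall>j\<in>insert t M. \<forall>l\<in>{1..n}. cmod (x' j l) \<le> 1" using assms(4) x by (simp add: x'_def)
  from mp[OF spec[OF assms(3)[unfolded mult_bounded_def], of x'] this]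
  show "cmod (\<Sum>i\<in>PiE M (\<lambda>_. {1..n}). (\<Sum>l=1..n. a (i(t := l)) * z l) * (\<Prod>j\<in>M. x j (i j))) \<le> K"
    unfolding eq .
qed

lemma cell_mass_insert:
  assumes "finite M" "t \<notin> M" "S \<subseteq> M" "\<And>s. s \<in> insert t M \<Longrightarrow> finite (X s)"
  shows "cell_mass (insert t M) X f S x = (\<Sum>i\<in>{i\<in>PiE M X. restrict i S = x}. \<Sum>y\<in>X t. (f (i(t := y)))\<^sup>2)"
proof -
  have fin: "finite (PiE M X)" "finite (PiE (insert t M) X)" using assms by (auto intro!: finite_PiE)
  have restr: "restrict (i(t := y)) S = restrict i S" for i y using assms by (auto simp: restrict_def fun_eq_iff)
  have "cell_mass (insert t M) X f S x = (\<Sum>i\<in>PiE (insert t M) X. if restrict i S = x then (f i)\<^sup>2 else 0)"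
    unfolding cell_mass_def using fin by (simp add: sum.inter_filter)
  also have "\<dots> = (\<Sum>y\<in>X t. \<Sum>i\<in>PiE M X. if restrict i S = x then (f (i(t := y)))\<^sup>2 else 0)"
    unfolding sum_PiE_insert[OF assms(2)] restr ..
  also have "\<dots> = (\<Sum>i\<in>PiE M X. if restrict i S = x then (\<Sum>y\<in>X t. (f (i(t := y)))\<^sup>2) else 0)"
    by (subst sum.swap) (auto intro!: sum.cong)
  finally show ?thesis using fin by (simp add: sum.inter_filter)
qed

lemma KS_valid_sq:
  assumes A: "KS_valid q A" and q: "0 < q"
  shows "(\<Sum>k<N. (cmod (\<alpha> k))\<^sup>2) \<le> A\<^sup>2 * (\<integral>t. cmod (\<Sum>k<N. \<alpha> k * circ (t k)) powr q \<partial>torus_param N) powr (2 / q)"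
proof -
  define I where "I = (\<integral>t. cmod (\<Sum>k<N. \<alpha> k * circ (t k)) powr q \<partial>torus_param N)"
  have "(sqrt (\<Sum>k<N. (cmod (\<alpha> k))\<^sup>2))\<^sup>2 \<le> (A * I powr (1 / q))\<^sup>2"
    using A unfolding KS_valid_def I_def by (intro power_mono) (auto intro!: sum_nonneg)
  also have "\<dots> = A\<^sup>2 * I powr (2 / q)"
    by (simp add: power_mult_distrib power2_eq_square flip: powr_add)
  finally show ?thesis by (simp add: I_def sum_nonneg)
qed

text \<open>The coordinates outside \<open>S\<close> are averaged out one at a time, freezing the corresponding
  argument of the form at a random point of the torus.\<close>

lemma block_sum_le:
  assumes A: "KS_valid q A" and q: "0 < q" "q \<le> 2" and S: "finite S"
    and base: "\<And>b. mult_bounded S n b K \<Longrightarrow> (\<Sum>i\<in>PiE S (\<lambda>_. {1..n}). cmod (b i) powr q) \<le> C"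
    and T: "finite T" "S \<inter> T = {}" and a: "mult_bounded (S \<union> T) n a K"
  shows "block_sum q (S \<union> T) (\<lambda>_. {1..n}) (\<lambda>i. cmod (a i)) S \<le> A powr (q * card T) * C"
  using T a
proof (induction T arbitrary: a rule: finite_induct)
  case empty
  \<comment> \<open>Without outer coordinates the fibres are single points and the mixed norm is the
    plain \<ell> norm with exponent \<open>q\<close>.\<close>
  have "{i \<in> PiE S (\<lambda>_. {1..n}). restrict i S = x} = {x}" if "x \<in> PiE S (\<lambda>_. {1..n})" for x :: "'a \<Rightarrow> nat"
    using that by (auto simp: PiE_restrict)
  then have "block_sum q S (\<lambda>_. {1..n}) (\<lambda>i. cmod (a i)) S = (\<Sum>i\<in>PiE S (\<lambda>_. {1..n}). cmod (a i) powr q)"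
    unfolding block_sum_def cell_mass_def
    by (intro sum.cong refl) (auto simp: powr_powr simp flip: powr_numeral)
  moreover have "A > 0" using A by (simp add: KS_valid_def)
  ultimately show ?case using base[of a] empty by simp
next
  case (insert t T)
  let ?X = "\<lambda>_::'a. {1..n}"
  interpret prob_space "torus_param n" by (rule torus_param_prob)
  define M where "M = S \<union> T"
  have M: "finite M" "t \<notin> M" "S \<subseteq> M" "S \<union> insert t T = insert t M"
    using insert.hyps insert.prems S by (auto simp: M_def)
  have A1: "A \<ge> 1" using A by (simp add: KS_valid_def)
  \<comment> \<open>The form with slot \<open>t\<close> frozen at the torus point \<open>z\<close>.
    Torus coordinates start at 0 and index values at 1, hence \<open>Suc k\<close>.\<close>
  define b where "b z i = (\<Sum>k<n. a (i(t := Suc k)) * circ (z k))" for z i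
  have b_bounded: "mult_bounded M n (b z) K" for z
  proof -
    have "mult_bounded M n (\<lambda>i. \<Sum>l=1..n. a (i(t := l)) * circ (z (l - 1))) K"
      by (rule mult_bounded_insert) (use insert.prems M in auto)
    then show ?thesis by (simp add: b_def[abs_def] sum.atLeast1_atMost_eq)
  qed
  define c where "c x = {i\<in>PiE M ?X. restrict i S = x}" for x
  have finc: "finite (c x)" for x unfolding c_def using M by (auto intro!: finite_PiE)
  have cm: "cell_mass M ?X (\<lambda>i. cmod (b z i)) S x = (\<Sum>i\<in>c x. (cmod (b z i))\<^sup>2)" for z x
    by (simp add: cell_mass_def c_def)
  have b_int: "integrable (torus_param n) (\<lambda>z. cmod (b z i) powr q)" for i
    unfolding b_def using q by (intro steinhaus_integrable_powr) auto
  have [measurable]: "(\<lambda>z. b z i) \<in> borel_measurable (torus_param n)" for i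
    unfolding b_def by measurable
  have c_int: "integrable (torus_param n) (\<lambda>z. (\<Sum>i\<in>c x. (cmod (b z i))\<^sup>2) powr (q / 2))" for x
  proof (rule integrable_const_bound)
    define B where "B = (\<Sum>i\<in>c x. (\<Sum>k<n. cmod (a (i(t := Suc k))))\<^sup>2) powr (q / 2)"
    have "(\<Sum>i\<in>c x. (cmod (b z i))\<^sup>2) powr (q / 2) \<le> B" for z
      unfolding B_def b_def using q
      by (intro powr_mono2 sum_mono power_mono norm_steinhaus_le) (auto intro!: sum_nonneg)
    then show "AE z in torus_param n. norm ((\<Sum>i\<in>c x. (cmod (b z i))\<^sup>2) powr (q / 2)) \<le> B" by simp
  qed measurable
  \<comment> \<open>Khinchine-Steinhaus in the coordinate \<open>t\<close> for every
    \<open>i\<close> of the fibre, then Minkowski's inequality to move the integral outside the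
    \<ell>2 norm.\<close>
  have cell: "cell_mass (insert t M) ?X (\<lambda>i. cmod (a i)) S x powr (q / 2)
      \<le> A powr q * (\<integral>z. (\<Sum>i\<in>c x. (cmod (b z i))\<^sup>2) powr (q / 2) \<partial>torus_param n)" for x
  proof -
    have "cell_mass (insert t M) ?X (\<lambda>i. cmod (a i)) S x = (\<Sum>i\<in>c x. \<Sum>k<n. (cmod (a (i(t := Suc k))))\<^sup>2)"
      using M by (subst cell_mass_insert) (auto simp: c_def sum.atLeast1_atMost_eq)
    also have "\<dots> \<le> (\<Sum>i\<in>c x. A\<^sup>2 * (\<integral>z. cmod (b z i) powr q \<partial>torus_param n) powr (2 / q))"
      unfolding b_def by (intro sum_mono KS_valid_sq[OF A q(1)])
    also have "\<dots> = A\<^sup>2 * (\<Sum>i\<in>c x. (\<integral>z. cmod (b z i) powr q \<partial>torus_param n) powr (2 / q))"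
      by (simp add: sum_distrib_left)
    finally have "cell_mass (insert t M) ?X (\<lambda>i. cmod (a i)) S x powr (q / 2)
      \<le> (A\<^sup>2 * (\<Sum>i\<in>c x. (\<integral>z. cmod (b z i) powr q \<partial>torus_param n) powr (2 / q))) powr (q / 2)"
      using q by (intro powr_mono2) auto
    also have "\<dots> = A powr q * (\<Sum>i\<in>c x. (\<integral>z. cmod (b z i) powr q \<partial>torus_param n) powr (2 / q)) powr (q / 2)"
      using A1 by (simp add: powr_mult powr_powr sum_nonneg flip: powr_numeral)
    also have "\<dots> \<le> A powr q * (\<integral>z. (\<Sum>i\<in>c x. (cmod (b z i))\<^sup>2) powr (q / 2) \<partial>torus_param n)"
      using q b_int c_int finc by (intro mult_left_mono minkowski_integral_l2) auto
    finally show ?thesis .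
  qed
  \<comment> \<open>For each fixed \<open>z\<close> the form \<open>b z\<close> obeys the same bound
    \<open>K\<close>, so the estimate is uniform in \<open>z\<close> and survives integration over a
    probability space.\<close>
  have IH: "(\<Sum>x\<in>PiE S ?X. (\<Sum>i\<in>c x. (cmod (b z i))\<^sup>2) powr (q / 2)) \<le> A powr (q * card T) * C" for z
    using insert.IH[of "b z"] b_bounded[of z] insert.prems
    unfolding block_sum_def M_def[symmetric] cm by simp
  have "block_sum q (insert t M) ?X (\<lambda>i. cmod (a i)) S
      \<le> (\<Sum>x\<in>PiE S ?X. A powr q * (\<integral>z. (\<Sum>i\<in>c x. (cmod (b z i))\<^sup>2) powr (q / 2) \<partial>torus_param n))"
    unfolding block_sum_def by (intro sum_mono cell)
  also have "\<dots> = A powr q * (\<integral>z. (\<Sum>x\<in>PiE S ?X. (\<Sum>i\<in>c x. (cmod (b z i))\<^sup>2) powr (q / 2)) \<partial>torus_param n)"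
    using c_int by (simp add: sum_distrib_left)
  also have "\<dots> \<le> A powr q * (A powr (q * card T) * C)"
    using c_int IH by (intro mult_left_mono integral_le_const) auto
  also have "\<dots> = A powr (q * card (insert t T)) * C"
    using insert.hyps by (simp add: powr_add algebra_simps)
  finally show ?case unfolding M(4) .
qed

section \<open>Bohnenblust-Hille constants\<close>

lemma finite_multi_idx: "finite (multi_idx m n)"
  using finite_lists_length_eq[of "{1..n}" m] by (simp add: multi_idx_def conj_commute)

lemma multi_idx_nth: "l \<in> multi_idx m n \<Longrightarrow> j < m \<Longrightarrow> l ! j \<in> {1..n}"
  unfolding multi_idx_def using nth_mem by blast

lemma mult_sup_norm_upper:
  assumes x: "\<forall>j<m. \<forall>l\<in>{1..n}. cmod (x j l) \<le> 1"
  shows "cmod (\<Sum>l\<in>multi_idx m n. a l * (\<Prod>j<m. x j (l ! j))) \<le> mult_sup_norm m n a"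
  unfolding mult_sup_norm_def
proof (rule cSup_upper)
  \<comment> \<open>A real \<open>Sup\<close> dominates the members of its set only once the set is
    known to be bounded; here the triangle inequality gives the sum of the moduli of the
    coefficients.\<close>
  show "bdd_above {cmod (\<Sum>is\<in>multi_idx m n. a is * (\<Prod>j<m. x j (is ! j))) | x.
      \<forall>j<m. \<forall>l\<in>{1..n}. cmod (x j l) \<le> 1}"
  proof (rule bdd_aboveI)
    fix v assume "v \<in> {cmod (\<Sum>is\<in>multi_idx m n. a is * (\<Prod>j<m. x j (is ! j))) | x.
      \<forall>j<m. \<forall>l\<in>{1..n}. cmod (x j l) \<le> 1}"
    then obtain x where v: "v = cmod (\<Sum>is\<in>multi_idx m n. a is * (\<Prod>j<m. x j (is ! j)))"
      and x: "\<forall>j<m. \<forall>l\<in>{1..n}. cmod (x j l) \<le> 1" by blast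
    have "v \<le> (\<Sum>is\<in>multi_idx m n. cmod (a is) * (\<Prod>j<m. cmod (x j (is ! j))))"
      unfolding v by (rule order.trans[OF norm_sum]) (simp add: norm_mult prod_norm)
    also have "\<dots> \<le> (\<Sum>is\<in>multi_idx m n. cmod (a is) * 1)"
      using x multi_idx_nth by (intro sum_mono mult_left_mono prod_le_1) auto
    finally show "v \<le> (\<Sum>is\<in>multi_idx m n. cmod (a is) * 1)" .
  qed
qed (use x in blast)

lemma mult_sup_norm_least:
  assumes "\<And>x. \<forall>j<m. \<forall>l\<in>{1..n}. cmod (x j l) \<le> 1
    \<Longrightarrow> cmod (\<Sum>l\<in>multi_idx m n. a l * (\<Prod>j<m. x j (l ! j))) \<le> K"
  shows "mult_sup_norm m n a \<le> K"
  unfolding mult_sup_norm_def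
proof (rule cSup_least)
  have "cmod (\<Sum>is\<in>multi_idx m n. a is * (\<Prod>j<m. (\<lambda>_ _. 0) j (is ! j)))
    \<in> {cmod (\<Sum>is\<in>multi_idx m n. a is * (\<Prod>j<m. x j (is ! j))) | x.
      \<forall>j<m. \<forall>l\<in>{1..n}. cmod (x j l) \<le> 1}"
    by (intro CollectI exI[of _ "\<lambda>_ _. 0"]) simp
  then show "{cmod (\<Sum>is\<in>multi_idx m n. a is * (\<Prod>j<m. x j (is ! j))) | x.
      \<forall>j<m. \<forall>l\<in>{1..n}. cmod (x j l) \<le> 1} \<noteq> {}" by blast
qed (use assms in blast)

lemma mult_sup_norm_nonneg: "mult_sup_norm m n a \<ge> 0"
  using order.trans[OF norm_ge_zero mult_sup_norm_upper[of m n "\<lambda>_ _. 0" a]] by simp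

text \<open>Dictionary between lists and functions on \<open>S\<close>: \<open>h\<close> numbers the
  coordinates by list positions from 0, and \<open>h'\<close> is its inverse.\<close>

lemma bij_betw_multi_idx:
  assumes h: "\<And>s. s \<in> S \<Longrightarrow> h s < k" "\<And>s. s \<in> S \<Longrightarrow> h' (h s) = s"
    and h': "\<And>j. j < k \<Longrightarrow> h' j \<in> S" "\<And>j. j < k \<Longrightarrow> h (h' j) = j"
  shows "bij_betw (\<lambda>i. map (\<lambda>j. i (h' j)) [0..<k]) (PiE S (\<lambda>_. {1..n})) (multi_idx k n)"
    and "bij_betw (\<lambda>l. \<lambda>s\<in>S. l ! h s) (multi_idx k n) (PiE S (\<lambda>_. {1..n}))"
proof -
  let ?\<phi> = "\<lambda>i. map (\<lambda>j. i (h' j)) [0..<k]" and ?\<psi> = "\<lambda>l. \<lambda>s\<in>S. l ! h s"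
  have 1: "?\<psi> (?\<phi> i) = i" if i: "i \<in> PiE S (\<lambda>_. {1..n})" for i
  proof
    fix s show "?\<psi> (?\<phi> i) s = i s"
    proof (cases "s \<in> S")
      case False then show ?thesis using PiE_arb[OF i False] by simp
    qed (simp add: h)
  qed
  have 2: "?\<phi> (?\<psi> l) = l" if "l \<in> multi_idx k n" for l
  proof (rule nth_equalityI)
    show "length (?\<phi> (?\<psi> l)) = length l" using that by (simp add: multi_idx_def)
  qed (simp add: h')
  have 3: "?\<phi> i \<in> multi_idx k n" if "i \<in> PiE S (\<lambda>_. {1..n})" for i
  proof -
    have "i (h' j) \<in> {1..n}" if "j < k" for j
      using PiE_mem[OF \<open>i \<in> PiE S (\<lambda>_. {1..n})\<close> h'(1)[OF that]] .
    then show ?thesis by (auto simp: multi_idx_def)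
  qed
  have 4: "?\<psi> l \<in> PiE S (\<lambda>_. {1..n})" if "l \<in> multi_idx k n" for l
    by (rule PiE_I) (use multi_idx_nth[OF that h(1)] in auto)
  show "bij_betw ?\<phi> (PiE S (\<lambda>_. {1..n})) (multi_idx k n)"
    by (rule bij_betw_byWitness[where f' = ?\<psi>]) (intro ballI image_subsetI, rule 1 2 3 4, assumption)+
  show "bij_betw ?\<psi> (multi_idx k n) (PiE S (\<lambda>_. {1..n}))"
    by (rule bij_betw_byWitness[where f' = ?\<phi>]) (intro ballI image_subsetI, rule 1 2 3 4, assumption)+
qed

lemma mult_bounded_mult_sup_norm:
  "mult_bounded {..<m} n (\<lambda>i. a (map i [0..<m])) (mult_sup_norm m n a)"
  unfolding mult_bounded_def
proof (intro allI impI)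
  fix x :: "nat \<Rightarrow> nat \<Rightarrow> complex" assume x: "\<forall>j\<in>{..<m}. \<forall>l\<in>{1..n}. cmod (x j l) \<le> 1"
  have bij: "bij_betw (\<lambda>i. map i [0..<m]) (PiE {..<m} (\<lambda>_. {1..n})) (multi_idx m n)"
    using bij_betw_multi_idx(1)[of "{..<m}" "\<lambda>s. s" m "\<lambda>s. s"] by simp
  have "(\<Sum>l\<in>multi_idx m n. a l * (\<Prod>j<m. x j (l ! j)))
    = (\<Sum>i\<in>PiE {..<m} (\<lambda>_. {1..n}). a (map i [0..<m]) * (\<Prod>j<m. x j (map i [0..<m] ! j)))"
    by (rule sum.reindex_bij_betw[OF bij, symmetric])
  then show "cmod (\<Sum>i\<in>PiE {..<m} (\<lambda>_. {1..n}). a (map i [0..<m]) * (\<Prod>j<m. x j (i j))) \<le> mult_sup_norm m n a"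
    using mult_sup_norm_upper[of m n x a] x by simp
qed

definition BH_valid :: "real \<Rightarrow> real \<Rightarrow> nat \<Rightarrow> real \<Rightarrow> bool" where
  "BH_valid p q m C \<longleftrightarrow> C \<ge> 1 \<and> (\<forall>n (a :: nat list \<Rightarrow> complex).
     lorentz_norm p q (multi_idx m n) a \<le> C * mult_sup_norm m n a)"

text \<open>Transports the inequality for \<open>k\<close>-linear forms to any
  \<open>k\<close>-element coordinate set by numbering it; this supplies the base case of
  \<open>block_sum_le\<close>.\<close>

lemma BH_valid_sum_le:
  assumes B: "BH_valid q q k B" and q: "q > 0" and S: "finite S" "card S = k"
    and b: "mult_bounded S n b K"
  shows "(\<Sum>i\<in>PiE S (\<lambda>_. {1..n}). cmod (b i) powr q) \<le> (B * K) powr q"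
proof -
  obtain h where h: "bij_betw h S {..<k}"
    using S ex_bij_betw_finite_nat[of S] by (auto simp: atLeast0LessThan)
  define h' where "h' = inv_into S h"
  have hh: "h s < k" "h' (h s) = s" if "s \<in> S" for s
    using that bij_betwE[OF h] bij_betw_inv_into_left[OF h] by (auto simp: h'_def)
  have hh': "h' j \<in> S" "h (h' j) = j" if "j < k" for j
    using that bij_betwE[OF bij_betw_inv_into[OF h]] bij_betw_inv_into_right[OF h] by (auto simp: h'_def)
  define \<psi> where "\<psi> l = (\<lambda>s\<in>S. l ! h s)" for l :: "nat list"
  have \<psi>: "bij_betw \<psi> (multi_idx k n) (PiE S (\<lambda>_. {1..n}))"
    unfolding \<psi>_def[abs_def] by (rule bij_betw_multi_idx(2)[OF hh hh'])
  have sup: "mult_sup_norm k n (b \<circ> \<psi>) \<le> K"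
  proof (rule mult_sup_norm_least)
    fix x :: "nat \<Rightarrow> nat \<Rightarrow> complex" assume x: "\<forall>j<k. \<forall>l\<in>{1..n}. cmod (x j l) \<le> 1"
    have "(\<Prod>j<k. x j (l ! j)) = (\<Prod>s\<in>S. x (h s) (\<psi> l s))" for l
      by (subst prod.reindex_bij_betw[OF h, symmetric]) (simp add: \<psi>_def)
    then have "(\<Sum>l\<in>multi_idx k n. (b \<circ> \<psi>) l * (\<Prod>j<k. x j (l ! j)))
      = (\<Sum>l\<in>multi_idx k n. b (\<psi> l) * (\<Prod>s\<in>S. x (h s) (\<psi> l s)))" by simp
    also have "\<dots> = (\<Sum>i\<in>PiE S (\<lambda>_. {1..n}). b i * (\<Prod>s\<in>S. x (h s) (i s)))"
      by (rule sum.reindex_bij_betw[OF \<psi>])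
    finally show "cmod (\<Sum>l\<in>multi_idx k n. (b \<circ> \<psi>) l * (\<Prod>j<k. x j (l ! j))) \<le> K"
      using b[unfolded mult_bounded_def, rule_format, of "\<lambda>s. x (h s)"] x hh by simp
  qed
  have "(\<Sum>i\<in>PiE S (\<lambda>_. {1..n}). cmod (b i) powr q) powr (1 / q) = lorentz_norm q q (multi_idx k n) (b \<circ> \<psi>)"
    unfolding lorentz_norm_reindex[OF \<psi>, symmetric]
    using S q by (intro lorentz_norm_diag[symmetric] finite_PiE) auto
  also have "\<dots> \<le> B * mult_sup_norm k n (b \<circ> \<psi>)" using B by (simp add: BH_valid_def)
  also have "\<dots> \<le> B * K" using sup B by (intro mult_left_mono) (auto simp: BH_valid_def)
  finally have "((\<Sum>i\<in>PiE S (\<lambda>_. {1..n}). cmod (b i) powr q) powr (1 / q)) powr q \<le> (B * K) powr q"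
    using q by (intro powr_mono2) auto
  then show ?thesis using q by (simp add: powr_powr sum_nonneg)
qed

lemma block_sum_le_BH:
  assumes A: "KS_valid q A" and q: "0 < q" "q \<le> 2" and B: "BH_valid q q k B"
    and S: "S \<in> ksubsets k {..<m}"
  shows "block_sum q {..<m} (\<lambda>_. {1..n}) (\<lambda>i. cmod (a (map i [0..<m]))) S
    \<le> (A ^ (m - k) * B * mult_sup_norm m n a) powr q"
proof -
  define K where "K = mult_sup_norm m n a"
  have S': "S \<subseteq> {..<m}" "card S = k" "finite S" using S finite_subset[of S "{..<m}"] by (auto simp: ksubsets_def)
  have U: "S \<union> ({..<m} - S) = {..<m}" and c: "card ({..<m} - S) = m - k"
    using S' by (auto simp: card_Diff_subset)
  have "block_sum q (S \<union> ({..<m} - S)) (\<lambda>_. {1..n}) (\<lambda>i. cmod (a (map i [0..<m]))) S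
    \<le> A powr (q * card ({..<m} - S)) * (B * K) powr q"
    by (rule block_sum_le[OF A q S'(3)])
       (use BH_valid_sum_le[OF B q(1) S'(3,2)] mult_bounded_mult_sup_norm U in \<open>auto simp: K_def\<close>)
  moreover have "A powr (q * (m - k)) = (A ^ (m - k)) powr q"
    using A by (simp add: KS_valid_def powr_realpow[symmetric] powr_powr mult.commute)
  ultimately show ?thesis unfolding U c
    by (simp add: K_def powr_mult mult.assoc)
qed

section \<open>From block sums to Lorentz norms\<close>

context
  fixes m k n :: nat and a :: "nat list \<Rightarrow> complex"
  assumes k: "1 \<le> k" "k \<le> m"
begin

interpretation blei_setup "{..<m}" "\<lambda>_. {1..n}" k m "\<lambda>i. cmod (a (map i [0..<m]))"
  using k by unfold_locales auto

lemma lorentz_norm_multi_idx: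
  "lorentz_norm p q (multi_idx m n) a = lorentz_norm p q (PiE {..<m} (\<lambda>_. {1..n})) (\<lambda>i. a (map i [0..<m]))"
  using lorentz_norm_reindex[OF bij_betw_multi_idx(1)[of "{..<m}" "\<lambda>s. s" m "\<lambda>s. s" n], of p q a]
  by (simp add: o_def)

text \<open>The exponent \<open>3 / 2\<close> arises as follows: the sum over subsets contributes
  \<open>N\<close>, the cell bound contributes at most \<open>N powr (1 / (k + 1))\<close>, and the
  root of order \<open>q\<close> of their product is \<open>N powr (1 / 2 + 1 / k)\<close> with
  \<open>k \<ge> 1\<close>.\<close>

lemma lorentz_norm_le_block:
  assumes R: "R \<ge> 0"
    and block: "\<And>S. S \<in> ksubsets k {..<m} \<Longrightarrow>
      block_sum (2 * real k / (real k + 1)) {..<m} (\<lambda>_. {1..n}) (\<lambda>i. cmod (a (map i [0..<m]))) S \<le> R powr (2 * real k / (real k + 1))"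
  shows "lorentz_norm (2 * real m / (real m + 1)) (2 * real k / (real k + 1)) (multi_idx m n) a \<le> real (m choose k) powr (3 / 2) * R"
proof -
  let ?I = "PiE {..<m} (\<lambda>_. {1..n})" and ?b = "\<lambda>i. a (map i [0..<m])"
  define p q where "p = 2 * real m / (real m + 1)" and "q = 2 * real k / (real k + 1)"
  have q: "q > 0" using k by (simp add: q_def)
  \<comment> \<open>The last identity says that the Lorentz weight decays in the rank exactly like
    the weight in \<open>rank_weighted_sum_le\<close>.\<close>
  have qp: "0 < q / p" "q / p \<le> 1" "q / p - 1 = (real k / m - 1) / (real k + 1)"
  proof -
    have "q / p = (real k / real m) * ((real m + 1) / (real k + 1))" by (simp add: p_def q_def)
    also have "\<dots> = 1 + (real k / real m - 1) / (real k + 1)"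
    proof -
      have "x / y * ((y + 1) / (x + 1)) = 1 + (x / y - 1) / (x + 1)" if "x > 0" "y > 0" for x y :: real
      proof -
        have "x / y * ((y + 1) / (x + 1)) * (x + 1) = (1 + (x / y - 1) / (x + 1)) * (x + 1)"
          using that by (simp add: distrib_right) (simp add: field_simps)
        then show ?thesis using that by simp
      qed
      then show ?thesis using k by simp
    qed
    finally show e: "q / p - 1 = (real k / m - 1) / (real k + 1)" by simp
    have "real k / real m - 1 \<le> 0" using k by simp
    then have "(real k / m - 1) / (real k + 1) \<le> 0" by (intro divide_nonpos_pos) auto
    with e show "q / p \<le> 1" by simp
    show "0 < q / p" using k by (simp add: p_def q_def)
  qed
  obtain \<rho> where \<rho>: "bij_betw \<rho> ?I {1..card ?I}"
    and L: "lorentz_norm p q ?I ?b =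
      (\<Sum>i\<in>?I. cmod (?b i) powr q * (real (\<rho> i) powr (q / p) - real (\<rho> i - 1) powr (q / p))) powr (1 / q)"
    using lorentz_norm_enum[OF fin] by blast
  have \<rho>1: "\<rho> i \<ge> 1" if "i \<in> ?I" for i using bij_betwE[OF \<rho>] that by auto
  have "(\<Sum>i\<in>?I. cmod (?b i) powr q * (real (\<rho> i) powr (q / p) - real (\<rho> i - 1) powr (q / p)))
     \<le> (\<Sum>i\<in>?I. cmod (?b i) powr q * real (\<rho> i) powr (q / p - 1))"
    using qp \<rho>1 by (intro sum_mono mult_left_mono powr_diff_le) auto
  also have "\<dots> \<le> (\<Sum>S\<in>ksubsets k {..<m}. block_sum q {..<m} (\<lambda>_. {1..n}) (\<lambda>i. cmod (?b i)) S) * (real m / real k) powr (1 / (real k + 1))"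
    using rank_weighted_sum_le[OF \<rho>] unfolding q_def[symmetric] qp(3)[symmetric] .
  also have "\<dots> \<le> (\<Sum>S\<in>ksubsets k {..<m}. R powr q) * N powr (1 / (real k + 1))"
  proof (intro mult_mono sum_mono powr_mono2)
    have "real m / k * 1 \<le> real m / k * D" using D_pos k by (intro mult_left_mono) auto
    then show "real m / k \<le> N" using N_eq D_pos by (simp add: field_simps)
  qed (use block k in \<open>auto simp: q_def sum_nonneg\<close>)
  also have "\<dots> = N * R powr q * N powr (1 / (real k + 1))" using card_N by simp
  finally have "lorentz_norm p q ?I ?b \<le> (N * R powr q * N powr (1 / (real k + 1))) powr (1 / q)"
    unfolding L using qp \<rho>1 q
    by (intro powr_mono2 sum_nonneg mult_nonneg_nonneg) (auto intro!: powr_mono2)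
  also have "\<dots> = N powr (1 / q) * R * (N powr (1 / (real k + 1))) powr (1 / q)"
    using R q by (simp add: powr_mult powr_powr)
  also have "\<dots> = N powr (1 / q + 1 / (real k + 1) * (1 / q)) * R"
    unfolding powr_powr powr_add by simp
  also have "1 / q + 1 / (real k + 1) * (1 / q) = 1 / 2 + 1 / k"
    using k by (simp add: q_def field_simps)
  also have "N powr (1 / 2 + 1 / k) * R \<le> N powr (3 / 2) * R"
  proof (intro mult_right_mono powr_mono)
    have "m choose k \<ge> 1" using k by (simp add: Suc_leI)
    then show "N \<ge> 1" by (simp add: N_def)
  qed (use k R in \<open>auto simp: field_simps\<close>)
  finally show ?thesis by (simp add: lorentz_norm_multi_idx p_def q_def N_def)
qed

lemma lorentz_norm_diag_le_block:
  assumes R: "R \<ge> 0"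
    and block: "\<And>S. S \<in> ksubsets k {..<m} \<Longrightarrow>
      block_sum (2 * real k / (real k + 1)) {..<m} (\<lambda>_. {1..n}) (\<lambda>i. cmod (a (map i [0..<m]))) S \<le> R powr (2 * real k / (real k + 1))"
  shows "lorentz_norm (2 * real m / (real m + 1)) (2 * real m / (real m + 1)) (multi_idx m n) a \<le> R"
proof -
  let ?I = "PiE {..<m} (\<lambda>_. {1..n})" and ?b = "\<lambda>i. a (map i [0..<m])"
  define p where "p = 2 * real m / (real m + 1)"
  have p: "p > 0" using k by (simp add: p_def)
  have "(\<Sum>i\<in>?I. cmod (?b i) powr p) \<le> (R powr (2 * real k / (real k + 1))) powr ((real m / (real m + 1)) * ((real k + 1) / real k))"
    using blei[of "R powr (2 * real k / (real k + 1))", OF block] unfolding p_def by simp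
  also have "\<dots> = R powr p"
    unfolding powr_powr using k by (intro arg_cong2[where f = "(powr)"]) (auto simp: p_def divide_simps)
  finally have "(\<Sum>i\<in>?I. cmod (?b i) powr p) powr (1 / p) \<le> (R powr p) powr (1 / p)"
    using p by (intro powr_mono2) (auto simp: sum_nonneg)
  then show ?thesis
    using lorentz_norm_diag[OF fin p, of ?b] R p unfolding p_def[symmetric] lorentz_norm_multi_idx
    by (simp add: powr_powr)
qed

end

lemma BH_valid_lorentz:
  assumes k: "1 \<le> k" "k \<le> m" and A: "KS_valid (2 * real k / (real k + 1)) A"
    and B: "BH_valid (2 * real k / (real k + 1)) (2 * real k / (real k + 1)) k B"
  shows "BH_valid (2 * real m / (real m + 1)) (2 * real k / (real k + 1)) m
    (2 * real (m choose k) powr (3 / 2) * A ^ (m - k) * B)"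
proof -
  have q: "0 < 2 * real k / (real k + 1)" "2 * real k / (real k + 1) \<le> 2"
    using k by (auto simp: field_simps)
  have A1: "A \<ge> 1" and B1: "B \<ge> 1" using A B by (auto simp: KS_valid_def BH_valid_def)
  have AB: "A ^ (m - k) * B \<ge> 1"
    using A1 B1 mult_mono[of 1 "A ^ (m - k)" 1 B] by simp
  have N1: "real (m choose k) powr (3 / 2) \<ge> 1"
    using k by (intro ge_one_powr_ge_zero) (auto simp: Suc_leI)
  have C1: "2 * real (m choose k) powr (3 / 2) * A ^ (m - k) * B \<ge> 1"
    using mult_mono[OF N1 AB] AB by (simp add: mult.assoc)
  have "lorentz_norm (2 * real m / (real m + 1)) (2 * real k / (real k + 1)) (multi_idx m n) a
      \<le> 2 * real (m choose k) powr (3 / 2) * A ^ (m - k) * B * mult_sup_norm m n a" for n a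
  proof -
    have R: "A ^ (m - k) * B * mult_sup_norm m n a \<ge> 0" using AB mult_sup_norm_nonneg by simp
    have "lorentz_norm (2 * real m / (real m + 1)) (2 * real k / (real k + 1)) (multi_idx m n) a
      \<le> real (m choose k) powr (3 / 2) * (A ^ (m - k) * B * mult_sup_norm m n a)"
      using lorentz_norm_le_block[OF k R, of n a] block_sum_le_BH[OF A q B, of _ m n a]
      by (simp add: add.commute)
    \<comment> \<open>The factor 2 enters only here, by enlarging a nonnegative quantity.\<close>
    also have "\<dots> \<le> 2 * (real (m choose k) powr (3 / 2) * (A ^ (m - k) * B * mult_sup_norm m n a))"
      using mult_nonneg_nonneg[OF powr_ge_zero R, of "real (m choose k)" "3 / 2"] by linarith
    finally show ?thesis by (simp add: mult.assoc)
  qed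
  with C1 show ?thesis by (simp add: BH_valid_def)
qed

text \<open>Testing with the conjugate phases of the coefficients turns the linear form into the sum
  of their moduli.\<close>

lemma BH_valid_1: "BH_valid 1 1 1 1"
  unfolding BH_valid_def
proof (intro conjI allI)
  fix n and a :: "nat list \<Rightarrow> complex"
  define x :: "nat \<Rightarrow> nat \<Rightarrow> complex" where "x j l = cnj (sgn (a [l]))" for j l
  have sgn: "z * cnj (sgn z) = of_real (cmod z)" for z :: complex
    by (cases "z = 0") (simp_all add: sgn_eq complex_norm_square[symmetric] power2_eq_square)
  have "a l * x 0 (l ! 0) = of_real (cmod (a l))" if "l \<in> multi_idx 1 n" for l
  proof -
    have "l = [l ! 0]" using that by (auto simp: multi_idx_def length_Suc_conv)
    then have "x 0 (l ! 0) = cnj (sgn (a l))" by (simp add: x_def)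
    then show ?thesis by (simp only: sgn)
  qed
  then have "(\<Sum>l\<in>multi_idx 1 n. a l * (\<Prod>j<1. x j (l ! j))) = of_real (\<Sum>l\<in>multi_idx 1 n. cmod (a l))"
    by simp
  moreover have "(\<Sum>l\<in>multi_idx 1 n. cmod (a l)) \<ge> 0" by (simp add: sum_nonneg)
  moreover have "\<forall>j<1. \<forall>l\<in>{1..n}. cmod (x j l) \<le> 1" by (simp add: x_def norm_sgn)
  ultimately have "(\<Sum>l\<in>multi_idx 1 n. cmod (a l)) \<le> mult_sup_norm 1 n a"
    using mult_sup_norm_upper[of 1 n x a] by (metis abs_of_nonneg norm_of_real)
  then show "lorentz_norm 1 1 (multi_idx 1 n) a \<le> 1 * mult_sup_norm 1 n a"
    by (simp add: lorentz_norm_diag finite_multi_idx sum_nonneg)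
qed simp

text \<open>The Khinchine constants \<open>1 + 1 / j\<close> telescope.\<close>

lemma BH_valid_linear:
  assumes "j \<ge> 1"
  shows "BH_valid (2 * real j / (real j + 1)) (2 * real j / (real j + 1)) j (real j)"
  using assms
proof (induction j rule: dec_induct)
  case base
  then show ?case using BH_valid_1 by simp
next
  case (step j)
  have q: "0 < 2 * real j / (real j + 1)" "2 * real j / (real j + 1) \<le> 2"
    using step by (auto simp: field_simps)
  have "lorentz_norm (2 * real (Suc j) / (real (Suc j) + 1)) (2 * real (Suc j) / (real (Suc j) + 1)) (multi_idx (Suc j) n) a
      \<le> real (Suc j) * mult_sup_norm (Suc j) n a" for n a
  proof -
    \<comment> \<open>A \<open>j\<close>-subset of \<open>j + 1\<close> coordinates leaves one
      coordinate to average out, so the Khinchine constant enters once.\<close>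
    have "(1 + 1 / real j) ^ (Suc j - j) * real j = real (Suc j)" using step by (simp add: field_simps)
    then show ?thesis
      using lorentz_norm_diag_le_block[of j "Suc j" "real (Suc j) * mult_sup_norm (Suc j) n a" n a] step(1)
        block_sum_le_BH[OF KS_valid_bound[OF step(1)] q step.IH, of _ "Suc j" n a] mult_sup_norm_nonneg[of "Suc j" n a]
      by (simp add: add.commute)
  qed
  then show ?case by (simp add: BH_valid_def)
qed

text \<open>An infimum over a closed, nonempty set of reals that is bounded below belongs to the
  set. Hence the best constants are finite and themselves admissible, and the extended reals can be
  left.\<close>

lemma Inf_ereal_attained:
  assumes "closed {C :: real. P C}" "P C0" "\<And>C. P C \<Longrightarrow> C \<ge> c"
  obtains C where "P C" "Inf {ereal C | C. P C} = ereal C"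
proof
  define C where "C = Inf {C. P C}"
  have bdd: "bdd_below {C. P C}" using assms(3) by (intro bdd_belowI[of _ c]) auto
  show "P C" using closed_contains_Inf[OF _ bdd assms(1)] assms(2) by (auto simp: C_def)
  then show "Inf {ereal C | C. P C} = ereal C"
    using cInf_lower[OF _ bdd] by (intro antisym Inf_lower Inf_greatest) (auto simp: C_def)
qed

lemma BH_mult_lorentz_eq: "BH_mult_lorentz p q m = Inf {ereal C | C. BH_valid p q m C}"
  by (simp add: BH_mult_lorentz_def BH_valid_def)

lemma KS_const_eq: "KS_const p = Inf {ereal A | A. KS_valid p A}"
  by (simp add: KS_const_def KS_valid_def)

lemma closed_BH_valid: "closed {C. BH_valid p q m C}"
  unfolding BH_valid_def by (intro closed_Collect_conj closed_Collect_all closed_Collect_le continuous_intros)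

lemma closed_KS_valid: "closed {A. KS_valid p A}"
  unfolding KS_valid_def by (intro closed_Collect_conj closed_Collect_all closed_Collect_le continuous_intros)

lemma BH_mult_lorentz_le: "BH_valid p q m C \<Longrightarrow> BH_mult_lorentz p q m \<le> ereal C"
  unfolding BH_mult_lorentz_eq by (intro Inf_lower) auto

theorem theorem4p11:
  shows "(\<forall>m k :: nat. 1 \<le> k \<and> k \<le> m \<longrightarrow>
            BH_mult_lorentz (2 * real m / (real m + 1)) (2 * real k / (real k + 1)) m
              \<le> 2 * ereal (real (m choose k) powr (3 / 2))
                  * KS_const (2 * real k / (real k + 1)) ^ (m - k)
                  * BH_mult_lp (2 * real k / (real k + 1)) k)
       \<and> (\<forall>k :: nat. 1 \<le> k \<longrightarrow> (\<exists>\<delta> :: real. \<delta> > 0 \<and> (\<forall>m :: nat. m > k \<longrightarrow>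
            BH_mult_lorentz (2 * real m / (real m + 1))
                (2 * real (m - k) / (real (m - k) + 1)) m
              \<le> ereal (real m powr \<delta>))))"
proof (intro conjI allI impI)
  fix m k :: nat assume "1 \<le> k \<and> k \<le> m"
  then have k: "1 \<le> k" "k \<le> m" by auto
  let ?q = "2 * real k / (real k + 1)"
  obtain A where A: "KS_valid ?q A" "KS_const ?q = ereal A"
    unfolding KS_const_eq
    by (rule Inf_ereal_attained[OF closed_KS_valid KS_valid_bound[OF k(1)], of 1]) (auto simp: KS_valid_def)
  obtain B where B: "BH_valid ?q ?q k B" "BH_mult_lp ?q k = ereal B"
    unfolding BH_mult_lp_def BH_mult_lorentz_eq
    by (rule Inf_ereal_attained[OF closed_BH_valid BH_valid_linear[OF k(1)], of 1]) (auto simp: BH_valid_def)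
  have "2 * ereal (real (m choose k) powr (3 / 2)) * KS_const ?q ^ (m - k) * BH_mult_lp ?q k
     = ereal (2 * real (m choose k) powr (3 / 2) * A ^ (m - k) * B)"
    unfolding A(2) B(2) by simp
  then show "BH_mult_lorentz (2 * real m / (real m + 1)) ?q m
      \<le> 2 * ereal (real (m choose k) powr (3 / 2)) * KS_const ?q ^ (m - k) * BH_mult_lp ?q k"
    using BH_mult_lorentz_le[OF BH_valid_lorentz[OF k A(1) B(1)]] by simp
next
  fix k :: nat assume k: "1 \<le> k"
  show "\<exists>\<delta> :: real. \<delta> > 0 \<and> (\<forall>m :: nat. m > k \<longrightarrow>
      BH_mult_lorentz (2 * real m / (real m + 1)) (2 * real (m - k) / (real (m - k) + 1)) m \<le> ereal (real m powr \<delta>))"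
  \<comment> \<open>With \<open>j = m - k\<close> and \<open>m \<ge> 2\<close>, the factors 2 and
    \<open>BH(j) \<le> j\<close> cost one power of \<open>m\<close> each. By symmetry the binomial
    is \<open>m choose k\<close>, at most \<open>m ^ k\<close>, which costs
    \<open>3 / 2 * k\<close>. Each of the \<open>k\<close> Khinchine factors is at most
    \<open>1 + 1 / j \<le> 2 \<le> m\<close>.\<close>
  proof (intro exI[of _ "2 + 5 / 2 * real k"] conjI allI impI)
    fix m :: nat assume m: "m > k"
    define j where "j = m - k"
    have j: "1 \<le> j" "j \<le> m" "m - j = k" using m by (auto simp: j_def)
    have m2: "real m \<ge> 2" using k m by simp
    have "2 * real (m choose j) powr (3 / 2) * (1 + 1 / real j) ^ (m - j) * real j
        \<le> real m * (real m powr k) powr (3 / 2) * real m ^ k * real m"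
    proof (intro mult_mono powr_mono2)
      have "m choose j = m choose k" using binomial_symmetric[of k m] m by (simp add: j_def)
      moreover have "real (m choose k) \<le> real (m ^ k)" using binomial_le_pow[of k m] m by (simp only: of_nat_le_iff)
      ultimately show "real (m choose j) \<le> real m powr k" using m2 by (simp add: powr_realpow)
      have "1 + 1 / real j \<le> real m" 
      proof -
        have "1 / real j \<le> 1" using j by simp
        then show ?thesis using m2 by linarith
      qed
      then show "(1 + 1 / real j) ^ (m - j) \<le> real m ^ k" unfolding j(3) by (intro power_mono) auto
    qed (use j m2 in auto)
    also have "\<dots> = real m powr (2 + 5 / 2 * real k)"
    proof -
      have "real m powr (2 + 5 / 2 * real k) = real m powr (1 + k * (3 / 2) + k + 1)" by (simp add: field_simps)
      then show ?thesis using m2 by (simp only: powr_add powr_powr) (simp add: powr_realpow)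
    qed
    finally show "BH_mult_lorentz (2 * real m / (real m + 1)) (2 * real (m - k) / (real (m - k) + 1)) m
        \<le> ereal (real m powr (2 + 5 / 2 * real k))"
      using BH_mult_lorentz_le[OF BH_valid_lorentz[OF j(1,2) KS_valid_bound[OF j(1)] BH_valid_linear[OF j(1)]]]
      unfolding j_def[symmetric] by (meson ereal_less_eq(3) order_trans)
  qed simp
qed

end
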